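(* For every integer $n\geq 1$, $$\left|L_n(1)-\sqrt{\frac{e}{\pi}}\cdot \frac{\cos \left(2\sqrt{n}-\frac{\pi}{4}\right)}{n^{1/4}}+\frac{17}{48}\sqrt{\frac{e}{\pi}}\,\frac{\sin\left(2\sqrt{n}-\frac{\pi}{4}\right)}{n^{3/4}}\right|<\frac{0.51}{n}.$$
   Context: For an integer $n\ge 0$, $L_n$ denotes the classical Laguerre polynomial $$L_n(x) = \frac{1}{n!} e^x \left(\frac{d}{dx}\right)^n (e^{-x}x^n) = \sum_{k=0}^{n} \frac{1}{k!} \binom{n}{k} (-x)^{k}.$$ *)

theory Defs
  imports "HOL-Analysis.Analysis"
begin

definition Laguerre :: "nat \<Rightarrow> real \<Rightarrow> real" where
  "Laguerre n x = (\<Sum>k\<le>n. 1 / fact k * real (n choose k) * (- x) ^ k)"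

lemma leibniz_iterated:
  fixes f g :: "nat \<Rightarrow> real \<Rightarrow> real"
  assumes f: "\<And>k t. (f k has_real_derivative f (Suc k) t) (at t)"
    and g: "\<And>k t. (g k has_real_derivative g (Suc k) t) (at t)"
  shows "(deriv ^^ m) (\<lambda>t. f 0 t * g 0 t) =
    (\<lambda>t. \<Sum>k\<le>m. real (m choose k) * f (m - k) t * g k t)"
proof (induction m)
  case 0
  show ?case by simp
next
  case (Suc m)
  have "deriv (\<lambda>t. \<Sum>k\<le>m. real (m choose k) * f (m - k) t * g k t) t =
      (\<Sum>k\<le>Suc m. real (Suc m choose k) * f (Suc m - k) t * g k t)" for t
  proof -
    have "((\<lambda>t. \<Sum>k\<le>m. real (m choose k) * f (m - k) t * g k t) has_real_derivative
        (\<Sum>k\<le>m. real (m choose k) * (f (Suc (m - k)) t * g k t + f (m - k) t * g (Suc k) t))) (at t)"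
      by (rule DERIV_sum) (auto intro!: derivative_eq_intros f g simp: algebra_simps)
    then have "deriv (\<lambda>t. \<Sum>k\<le>m. real (m choose k) * f (m - k) t * g k t) t =
        (\<Sum>k\<le>m. real (m choose k) * (f (Suc (m - k)) t * g k t + f (m - k) t * g (Suc k) t))"
      by (rule DERIV_imp_deriv)
    also have "\<dots> = (\<Sum>k\<le>m. real (m choose k) * f (Suc m - k) t * g k t)
        + (\<Sum>k\<le>m. real (m choose k) * f (m - k) t * g (Suc k) t)"
      by (simp add: sum.distrib [symmetric] algebra_simps Suc_diff_le)
    also have "(\<Sum>k\<le>m. real (m choose k) * f (Suc m - k) t * g k t) =
        (\<Sum>k\<le>Suc m. real (m choose k) * f (Suc m - k) t * g k t)"
      by simp
    also have "\<dots> = f (Suc m) t * g 0 t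
        + (\<Sum>k\<le>m. real (m choose Suc k) * f (m - k) t * g (Suc k) t)"
      by (subst sum.atMost_Suc_shift) simp
    also have "\<dots> + (\<Sum>k\<le>m. real (m choose k) * f (m - k) t * g (Suc k) t) =
        (\<Sum>k\<le>Suc m. real (Suc m choose k) * f (Suc m - k) t * g k t)"
      by (subst sum.atMost_Suc_shift) (simp add: sum.distrib [symmetric] algebra_simps)
    finally show ?thesis .
  qed
  then show ?case by (simp add: Suc.IH fun_eq_iff)
qed

lemma Laguerre_Rodrigues:
  "Laguerre n x = 1 / fact n * exp x * (deriv ^^ n) (\<lambda>t. exp (- t) * t ^ n) x"
proof -
  define f :: "nat \<Rightarrow> real \<Rightarrow> real" where "f k t = (- 1) ^ k * exp (- t)" for k t
  define g :: "nat \<Rightarrow> real \<Rightarrow> real"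
    where "g k t = (if k \<le> n then fact n / fact (n - k) * t ^ (n - k) else 0)" for k t
  have f: "(f k has_real_derivative f (Suc k) t) (at t)" for k t
    unfolding f_def by (auto intro!: derivative_eq_intros)
  have g: "(g k has_real_derivative g (Suc k) t) (at t)" for k t
  proof (cases "k < n")
    case True
    then obtain d where d: "n - k = Suc d" "n - Suc k = d"
      by (metis Suc_diff_Suc)
    have "fact n / fact (Suc d) * (real (Suc d) * t ^ d) = fact n / fact d * t ^ d"
      by (simp del: of_nat_Suc)
    then have "((\<lambda>t. fact n / fact (Suc d) * t ^ Suc d) has_real_derivative
        fact n / fact d * t ^ d) (at t)"
      using DERIV_cmult [OF DERIV_pow [of "Suc d" t], of "fact n / fact (Suc d)"]
      by (simp del: of_nat_Suc power_Suc fact_Suc)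
    then show ?thesis using True d by (simp add: g_def [abs_def])
  next
    case False
    then show ?thesis by (cases "k = n") (auto simp: g_def [abs_def])
  qed
  have "(deriv ^^ n) (\<lambda>t. exp (- t) * t ^ n) x =
      (\<Sum>k\<le>n. real (n choose k) * f (n - k) x * g k x)"
    using leibniz_iterated [of f g n, OF f g] by (simp add: f_def g_def)
  also have "\<dots> = (\<Sum>k\<le>n. real (n choose (n - k)) * f (n - (n - k)) x * g (n - k) x)"
    by (rule sum.reindex_bij_witness [of _ "\<lambda>k. n - k" "\<lambda>k. n - k"]) auto
  also have "\<dots> = (\<Sum>k\<le>n. fact n * exp (- x) * (1 / fact k * real (n choose k) * (- x) ^ k))"
    by (rule sum.cong)
      (auto simp: f_def g_def binomial_symmetric [symmetric] power_minus [of x])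
  also have "\<dots> = fact n * exp (- x) * Laguerre n x"
    by (simp add: Laguerre_def sum_distrib_left)
  finally show ?thesis by (simp add: exp_minus field_simps)
qed

end

theory Submission
  imports Defs
begin

text \<open>
The value \<open>L\<^sub>n(1)\<close> is the average over a quarter circle of an even Hermite polynomial,
\<open>L\<^sub>n(1) = (2/\<pi>) \<integral> h(cos \<phi>) d\<phi>\<close> over \<open>[0, \<pi>/2]\<close>, where \<open>h\<close> is \<open>H\<^sub>2\<^sub>n\<close> scaled to \<open>h(0) = 1\<close>
(\<open>even_hermite_cos_has_integral\<close>). The Hermite function \<open>g(t) = exp(- t\<^sup>2/2) h(t)\<close> satisfies
\<open>g'' + (\<kappa>\<^sup>2 + 1 - t\<^sup>2) g = 0\<close> with \<open>\<kappa> = 2 \<surd>n\<close>, an equation without singularity, so variation of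
constants from \<open>t = 0\<close> gives \<open>g(t) = cos \<kappa>t - (t - t\<^sup>3/3) sin \<kappa>t / (2\<kappa>) + O(\<kappa>\<^sup>-\<^sup>2)\<close> on \<open>[0, 1]\<close>
with an explicit constant (\<open>perturbed_cos_approx\<close>). The summand \<open>1\<close> is treated as part of the
perturbation, rather than moved into the frequency, so that the phase \<open>2 \<surd>n\<close> of the theorem
appears at once.

The average of the resulting oscillating function is governed by the endpoint \<open>\<phi> = 0\<close>, where
\<open>t = cos \<phi> = 1\<close>. There \<open>exp(t\<^sup>2/2) = \<surd>e exp(- sin\<^sup>2 \<phi> / 2)\<close> is expanded in \<open>sin\<^sup>2 \<phi>\<close>. The terms of
order zero and two are Bessel functions, the rest vanishes to fourth order at \<open>\<phi> = 0\<close> and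
integration by parts shows that it contributes \<open>O(\<kappa>\<^sup>-\<^sup>2)\<close>. This leaves
\<open>L\<^sub>n(1) = \<surd>e (J\<^sub>0(\<kappa>) - 5 J\<^sub>1(\<kappa>) / (6\<kappa>)) + O(\<kappa>\<^sup>-\<^sup>2)\<close> (\<open>Laguerre_near_oscillating_average\<close>,
\<open>oscillating_average_near_Bessel\<close>).

For the Bessel functions, \<open>j(z) = \<surd>z J\<^sub>0(z)\<close> solves \<open>j'' + (1 + 1/(4z\<^sup>2)) j = 0\<close>. Once the leading
behaviour \<open>j(z) ~ \<surd>(2/\<pi>) cos(z - \<pi>/4)\<close> is known, without any rate, variation of constants from
infinity yields the next term and an explicit error (\<open>Bessel_type_asymptotics\<close>). The leading
behaviour is the method of stationary phase, which rests on the Fresnel integral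
(\<open>fresnel_limit\<close>). The coefficient of the sine in the theorem arises as
\<open>(1/8 - 5/6)/2 = - 17/48\<close>, and the three errors add up to less than \<open>2.04/\<kappa>\<^sup>2 = 0.51/n\<close>.
\<close>

section \<open>The quarter-period average\<close>

definition avg :: "(real \<Rightarrow> real) \<Rightarrow> real" where
  "avg f = 2 / pi * integral {0..pi / 2} f"

lemma avg_le:
  assumes "continuous_on {0..pi / 2} f" "\<And>\<phi>. \<phi> \<in> {0..pi / 2} \<Longrightarrow> \<bar>f \<phi>\<bar> \<le> B"
  shows "\<bar>avg f\<bar> \<le> B"
proof -
  have "norm (integral {0..pi / 2} f) \<le> B * (pi / 2 - 0)"
    by (rule integral_bound) (use assms in auto)
  then show ?thesis by (simp add: avg_def abs_mult field_simps)
qed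

lemma abs_avg_diff_le:
  assumes "continuous_on {0..pi / 2} f" "continuous_on {0..pi / 2} g" "(h has_integral I) {0..pi / 2}"
    and "\<And>\<phi>. \<phi> \<in> {0..pi / 2} \<Longrightarrow> \<bar>f \<phi> - g \<phi>\<bar> \<le> h \<phi>"
  shows "\<bar>avg f - avg g\<bar> \<le> 2 / pi * I"
proof -
  have fg: "f integrable_on {0..pi / 2}" "g integrable_on {0..pi / 2}"
    using assms(1,2) by (auto intro: integrable_continuous_real)
  have "norm (integral {0..pi / 2} (\<lambda>\<phi>. f \<phi> - g \<phi>)) \<le> integral {0..pi / 2} h"
    by (rule Henstock_Kurzweil_Integration.integral_norm_bound_integral)
      (use assms in \<open>auto intro: integrable_diff fg has_integral_integrable\<close>)
  then have "\<bar>integral {0..pi / 2} f - integral {0..pi / 2} g\<bar> \<le> I"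
    using assms(3) fg by (simp add: integral_diff integral_unique)
  then have "2 / pi * \<bar>integral {0..pi / 2} f - integral {0..pi / 2} g\<bar> \<le> 2 / pi * I"
    by (intro mult_left_mono) auto
  moreover have "\<bar>avg f - avg g\<bar> = 2 / pi * \<bar>integral {0..pi / 2} f - integral {0..pi / 2} g\<bar>"
    unfolding avg_def right_diff_distrib [symmetric] abs_mult by simp
  ultimately show ?thesis by simp
qed

lemma avg_add:
  "continuous_on {0..pi / 2} f \<Longrightarrow> continuous_on {0..pi / 2} g
    \<Longrightarrow> avg (\<lambda>\<phi>. f \<phi> + g \<phi>) = avg f + avg g"
  by (simp add: avg_def integral_add integrable_continuous_real distrib_left)

lemma avg_diff:
  "continuous_on {0..pi / 2} f \<Longrightarrow> continuous_on {0..pi / 2} g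
    \<Longrightarrow> avg (\<lambda>\<phi>. f \<phi> - g \<phi>) = avg f - avg g"
  by (simp add: avg_def integral_diff integrable_continuous_real right_diff_distrib)

lemma avg_cmult: "avg (\<lambda>\<phi>. c * f \<phi>) = c * avg f"
  by (simp add: avg_def)

text \<open>
Integration by parts in a form that suits oscillating integrands: an explicit function \<open>A\<close> that
vanishes, or at least agrees, at the two ends is a primitive of \<open>F\<close> up to a small pointwise
error \<open>e\<close>. The derivative is taken in the interior only, since in the applications \<open>A\<close> contains
quotients whose denominator vanishes at \<open>\<phi> = 0\<close>.
\<close>

lemma abs_avg_le_of_approximate_antiderivative:
  assumes F: "continuous_on {0..pi / 2} F"
    and A: "continuous_on {0..pi / 2} A" "A (pi / 2) = A 0"
    and A': "\<And>\<phi>. 0 < \<phi> \<Longrightarrow> \<phi> < pi / 2 \<Longrightarrow> (A has_real_derivative F \<phi> + e \<phi>) (at \<phi>)"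
    and e: "\<And>\<phi>. 0 < \<phi> \<Longrightarrow> \<phi> < pi / 2 \<Longrightarrow> \<bar>e \<phi>\<bar> \<le> \<epsilon>"
  shows "\<bar>avg F\<bar> \<le> \<epsilon>"
proof -
  define Y where "Y \<phi> = integral {0..\<phi>} F - A \<phi>" for \<phi>
  have "norm (Y (pi / 2) - Y 0) \<le> \<epsilon> * (pi / 2) - \<epsilon> * 0"
  proof (rule differentiable_bound_general)
    show "continuous_on {0..pi / 2} Y"
      unfolding Y_def by (intro continuous_intros indefinite_integral_continuous_1 integrable_continuous_real F A)
    fix \<phi> :: real assume p: "0 < \<phi>" "\<phi> < pi / 2"
    have "((\<lambda>u. integral {0..u} F) has_vector_derivative F \<phi>) (at \<phi> within {0..pi / 2})"
      by (rule integral_has_vector_derivative [OF F]) (use p in auto)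
    then have "((\<lambda>u. integral {0..u} F) has_real_derivative F \<phi>) (at \<phi>)"
      using p by (simp add: at_within_Icc_at has_real_derivative_iff_has_vector_derivative)
    from DERIV_diff [OF this A' [OF p]]
    show "(Y has_vector_derivative - e \<phi>) (at \<phi>)"
      unfolding Y_def [abs_def] by (simp add: has_real_derivative_iff_has_vector_derivative)
    show "norm (- e \<phi>) \<le> \<epsilon>" using e [OF p] by simp
    show "((\<lambda>x. \<epsilon> * x) has_vector_derivative \<epsilon>) (at \<phi>)"
      unfolding has_real_derivative_iff_has_vector_derivative [symmetric]
      by (auto intro!: derivative_eq_intros)
  qed (auto intro!: continuous_intros)
  then have "\<bar>integral {0..pi / 2} F\<bar> \<le> \<epsilon> * (pi / 2)" by (simp add: Y_def A)
  then show ?thesis by (simp add: avg_def abs_mult field_simps)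
qed

lemma has_real_derivative_avg:
  assumes "\<And>z \<phi>. ((\<lambda>z. f z \<phi>) has_real_derivative f' z \<phi>) (at z)"
    and "\<And>z. continuous_on {0..pi / 2} (f z)"
    and "continuous_on (UNIV \<times> {0..pi / 2}) (\<lambda>(z, \<phi>). f' z \<phi>)"
  shows "((\<lambda>z. avg (f z)) has_real_derivative avg (f' z)) (at z)"
proof -
  have "((\<lambda>z. integral (cbox 0 (pi / 2)) (f z)) has_real_derivative integral (cbox 0 (pi / 2)) (f' z)) (at z within UNIV)"
    by (rule leibniz_rule_field_derivative)
      (use assms in \<open>auto intro: integrable_continuous_real\<close>)
  then show ?thesis
    unfolding avg_def by (auto intro!: derivative_eq_intros)
qed

section \<open>Laguerre values as averages of Hermite polynomials\<close>

text \<open>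
The Wallis integral. Differentiating \<open>sin \<phi> cos\<^sup>2\<^sup>k\<^sup>+\<^sup>1 \<phi>\<close>, which vanishes at both ends, gives the
recursion \<open>(2k+2) I\<^sub>k\<^sub>+\<^sub>1 = (2k+1) I\<^sub>k\<close>.
\<close>

lemma cospow_has_integral:
  "((\<lambda>\<phi>::real. cos \<phi> ^ (2 * k)) has_integral (pi / 2 * (real ((2 * k) choose k) / 4 ^ k))) {0..pi / 2}"
proof (induction k)
  case 0
  have "((\<lambda>x::real. 1::real) has_integral (pi/2)) {0..pi/2}"
    using has_integral_const_real[of "1::real" 0 "pi/2"] by simp
  then show ?case by simp
next
  case (Suc k)
  let ?D = "\<lambda>\<phi>::real. real (2 * k + 2) * cos \<phi> ^ (2 * Suc k) - real (2 * k + 1) * cos \<phi> ^ (2 * k)"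
  have "(?D has_integral (sin (pi/2) * cos (pi/2) ^ (2 * k + 1) - sin 0 * cos 0 ^ (2 * k + 1))) {0..pi/2}"
  proof (rule fundamental_theorem_of_calculus)
    fix x :: real
    have "((\<lambda>x. sin x * cos x ^ (2 * k + 1)) has_real_derivative ?D x) (at x)"
    proof -
      have s: "sin x * sin x = 1 - cos x * cos x"
        using sin_cos_squared_add [of x] by (simp add: power2_eq_square)
      have "real (2 * k + 1) * cos x ^ (2 * k) * - sin x * sin x
          = - real (2 * k + 1) * cos x ^ (2 * k) * (sin x * sin x)" by (simp add: algebra_simps)
      also have "\<dots> = ?D x - cos x * cos x ^ (2 * k + 1)"
        unfolding s by (simp add: algebra_simps)
      finally show ?thesis
        by (auto intro!: derivative_eq_intros simp del: power_Suc simp: algebra_simps)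
    qed
    then show "((\<lambda>x. sin x * cos x ^ (2 * k + 1)) has_vector_derivative ?D x) (at x within {0..pi/2})"
      by (simp add: has_real_derivative_iff_has_vector_derivative has_vector_derivative_at_within)
  qed simp
  then have "(?D has_integral 0) {0..pi/2}" by simp
  from has_integral_mult_right [OF has_integral_add [OF this has_integral_mult_right [OF Suc.IH, of "real (2 * k + 1)"]], of "1 / real (2 * k + 2)"]
  have "((\<lambda>\<phi>::real. cos \<phi> ^ (2 * Suc k)) has_integral
      (1 / real (2 * k + 2) * (real (2 * k + 1) * (pi / 2 * (real ((2 * k) choose k) / 4 ^ k))))) {0..pi / 2}"
    by (simp add: divide_simps)
  moreover have "1 / real (2 * k + 2) * (real (2 * k + 1) * (pi / 2 * (real ((2 * k) choose k) / 4 ^ k)))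
     = pi / 2 * (real ((2 * Suc k) choose Suc k) / 4 ^ Suc k)"
  proof -
    have c: "real ((2 * m) choose m) = fact (2 * m) / (fact m * fact m)" for m
      using binomial_fact [of m "2 * m", where 'a = real] by simp
    have f: "(fact (2 * Suc k) :: real) = (real (2 * k + 2) * real (2 * k + 1)) * fact (2 * k)"
      by (simp add: algebra_simps)
    have g: "real (2 * k + 2) = 2 * real (Suc k)" by simp
    have "real (Suc k) \<noteq> 0" by simp
    then show ?thesis
      unfolding c f unfolding g by (simp add: divide_simps del: of_nat_Suc)
  qed
  ultimately show ?case by simp
qed

text \<open>
This is \<open>(-1)\<^sup>n n!/(2n)! H\<^sub>2\<^sub>n(t)\<close> for the physicists' Hermite polynomial \<open>H\<^sub>2\<^sub>n\<close>, equivalently the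
confluent hypergeometric function with parameters \<open>-n\<close> and \<open>1/2\<close> at \<open>t\<^sup>2\<close>.
\<close>

definition even_hermite :: "nat \<Rightarrow> real \<Rightarrow> real" where
  "even_hermite n t = (\<Sum>k\<le>n. (- 4) ^ k * fact k * real (n choose k) / fact (2 * k) * t ^ (2 * k))"

text \<open>
A case of Uspensky's formula. The Wallis integral of \<open>t\<^sup>2\<^sup>k\<close> carries \<open>(2k)!/(4\<^sup>k k!\<^sup>2)\<close>, which
turns the coefficient \<open>(-4)\<^sup>k k!/(2k)!\<close> into \<open>(-1)\<^sup>k/k!\<close>.
\<close>

lemma even_hermite_cos_has_integral:
  "((\<lambda>\<phi>. even_hermite n (cos \<phi>)) has_integral (pi / 2 * Laguerre n 1)) {0..pi / 2}"
proof -
  have "((\<lambda>\<phi>. even_hermite n (cos \<phi>)) has_integral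
     (\<Sum>k\<le>n. (- 4) ^ k * fact k * real (n choose k) / fact (2 * k) * (pi / 2 * (real ((2 * k) choose k) / 4 ^ k)))) {0..pi / 2}"
    unfolding even_hermite_def by (intro has_integral_sum has_integral_mult_right cospow_has_integral) simp
  also have "(\<Sum>k\<le>n. (- 4) ^ k * fact k * real (n choose k) / fact (2 * k) * (pi / 2 * (real ((2 * k) choose k) / 4 ^ k)))
     = pi / 2 * Laguerre n 1"
    unfolding Laguerre_def sum_distrib_left
  proof (rule sum.cong, goal_cases)
    case (2 k)
    have 1: "(- 4 :: real) ^ k = (-1) ^ k * 4 ^ k" using power_mult_distrib[of "-1::real" 4 k] by simp
    have 2: "real ((2 * k) choose k) = fact (2 * k) / (fact k * fact k)"
      using binomial_fact[of k "2*k", where 'a=real] by simp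
    show ?case unfolding 1 2 by simp
  qed simp
  finally show ?thesis .
qed

text \<open>
Hermite's equation. The coefficients satisfy \<open>(2k+1)(2k+2) a\<^sub>k\<^sub>+\<^sub>1 = 4(k - n) a\<^sub>k\<close>.
\<close>

lemma even_hermite_ode:
  obtains p' where "\<And>t. (even_hermite n has_real_derivative p' t) (at t)"
    "\<And>t. (p' has_real_derivative 2 * t * p' t - 4 * real n * even_hermite n t) (at t)" "p' 0 = 0"
proof -
  define a :: "nat \<Rightarrow> real" where "a k = (- 4) ^ k * fact k * real (n choose k) / fact (2 * k)" for k
  have a_Suc: "a (Suc k) * (real (2 * k + 2) * real (2 * k + 1)) = (4 * real k - 4 * real n) * a k" for k
  proof -
    have "Suc k * (n choose Suc k) = (n - k) * (n choose k)"
      by (simp only: binomial_absorb_comp binomial_absorption)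
    then have "real (Suc k) * real (n choose Suc k) = real (n - k) * real (n choose k)"
      by (simp only: of_nat_mult [symmetric])
    also have "\<dots> = (real n - real k) * real (n choose k)"
      by (cases "k \<le> n") (simp_all add: of_nat_diff binomial_eq_0)
    finally have B: "real (Suc k) * real (n choose Suc k) = (real n - real k) * real (n choose k)" .
    have f: "(fact (2 * Suc k) :: real) = (real (2 * k + 2) * real (2 * k + 1)) * fact (2 * k)"
      by (simp add: algebra_simps)
    have pos: "real (2 * k + 2) * real (2 * k + 1) \<noteq> 0" by simp
    have "a (Suc k) * (real (2 * k + 2) * real (2 * k + 1))
        = (- 4) ^ Suc k * fact (Suc k) * real (n choose Suc k) / fact (2 * k)"
      unfolding a_def f using pos by (simp only: divide_divide_eq_left [symmetric] times_divide_eq_left nonzero_mult_div_cancel_right times_divide_eq_right mult.assoc[symmetric])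
    also have "\<dots> = - 4 * (- 4) ^ k * fact k * (real (Suc k) * real (n choose Suc k)) / fact (2 * k)"
      by simp
    finally show ?thesis unfolding B by (simp add: a_def algebra_simps diff_divide_distrib)
  qed
  define p' where "p' t = (\<Sum>k\<le>n. a k * (real (2 * k) * t ^ (2 * k - Suc 0)))" for t
  show ?thesis
  proof
    show "(even_hermite n has_real_derivative p' t) (at t)" for t
      unfolding even_hermite_def [abs_def] p'_def a_def
      by (rule DERIV_sum) (rule DERIV_cmult DERIV_pow)+
    show "p' 0 = 0" unfolding p'_def by (intro sum.neutral) auto
    fix t
    have drop0: "(\<Sum>k\<le>n. h k) = (\<Sum>k<n. h (Suc k))" if "h 0 = 0" for h :: "nat \<Rightarrow> real"
      using sum.lessThan_Suc_shift [of h n] that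
      by (simp add: lessThan_Suc_atMost del: sum.lessThan_Suc)
    have "(p' has_real_derivative (\<Sum>k\<le>n. a k * (real (2 * k) * (real (2 * k - Suc 0) * t ^ (2 * k - Suc 0 - Suc 0))))) (at t)"
      unfolding p'_def [abs_def] by (rule DERIV_sum) (rule DERIV_cmult DERIV_pow)+
    also have "(\<Sum>k\<le>n. a k * (real (2 * k) * (real (2 * k - Suc 0) * t ^ (2 * k - Suc 0 - Suc 0))))
       = (\<Sum>k<n. a (Suc k) * (real (2 * k + 2) * real (2 * k + 1)) * t ^ (2 * k))"
      by (subst drop0) (simp_all add: mult_ac)
    also have "\<dots> = (\<Sum>k\<le>n. (4 * real k - 4 * real n) * a k * t ^ (2 * k))"
      unfolding a_Suc by (simp flip: lessThan_Suc_atMost)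
    also have "\<dots> = (\<Sum>k\<le>n. 2 * t * (a k * (real (2 * k) * t ^ (2 * k - Suc 0))) - 4 * real n * (a k * t ^ (2 * k)))"
    proof (rule sum.cong)
      fix k
      show "(4 * real k - 4 * real n) * a k * t ^ (2 * k)
        = 2 * t * (a k * (real (2 * k) * t ^ (2 * k - Suc 0))) - 4 * real n * (a k * t ^ (2 * k))"
        by (cases k) (simp_all add: algebra_simps)
    qed simp
    also have "\<dots> = 2 * t * p' t - 4 * real n * even_hermite n t"
      unfolding p'_def even_hermite_def a_def [symmetric] sum_distrib_left sum_subtractf ..
    finally show "(p' has_real_derivative 2 * t * p' t - 4 * real n * even_hermite n t) (at t)" .
  qed
qed

section \<open>A perturbed harmonic oscillator\<close>

text \<open>
Variation of constants for \<open>d'' + \<kappa>\<^sup>2 d = \<rho>\<close> from rest: \<open>\<kappa> d(t)\<close> is the integral of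
\<open>\<rho>(u) sin \<kappa>(t - u)\<close>, hence at most the integral of any majorant \<open>\<psi>\<close> of \<open>\<bar>\<rho>\<bar>\<close>. The function \<open>Y\<close> in
the proof has \<open>\<rho>(u) sin \<kappa>(t - u)\<close> as derivative and runs from \<open>0\<close> to \<open>\<kappa> d(t)\<close>.
\<close>

lemma oscillator_bound:
  fixes d d' \<rho> B \<psi> :: "real \<Rightarrow> real"
  assumes d: "\<And>u. (d has_real_derivative d' u) (at u)"
    and d': "\<And>u. (d' has_real_derivative \<rho> u - \<kappa>\<^sup>2 * d u) (at u)"
    and d0: "d 0 = 0" "d' 0 = 0"
    and B: "\<And>u. (B has_real_derivative \<psi> u) (at u)" "B 0 = 0"
    and bd: "\<And>u. 0 < u \<Longrightarrow> u < t \<Longrightarrow> \<bar>\<rho> u\<bar> \<le> \<psi> u"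
    and t: "0 \<le> t"
  shows "\<bar>\<kappa> * d t\<bar> \<le> B t"
proof (cases "t = 0")
  case True
  then show ?thesis by (simp add: d0 B)
next
  case False
  define Y where "Y u = d' u * sin (\<kappa> * (t - u)) + \<kappa> * d u * cos (\<kappa> * (t - u))" for u
  have Y: "(Y has_real_derivative \<rho> u * sin (\<kappa> * (t - u))) (at u)" for u
    unfolding Y_def [abs_def]
    by (auto intro!: derivative_eq_intros d d') (simp add: algebra_simps power2_eq_square)
  have "norm (Y t - Y 0) \<le> B t - B 0"
  proof (rule differentiable_bound_general)
    show "0 < t" using t False by simp
    show "continuous_on {0..t} Y" "continuous_on {0..t} B"
      by (auto intro!: continuous_at_imp_continuous_on DERIV_isCont [OF Y] DERIV_isCont [OF B(1)])
    show "(Y has_vector_derivative \<rho> u * sin (\<kappa> * (t - u))) (at u)" for u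
      using Y by (simp add: has_real_derivative_iff_has_vector_derivative)
    show "(B has_vector_derivative \<psi> u) (at u)" for u
      using B(1) by (simp add: has_real_derivative_iff_has_vector_derivative)
    show "norm (\<rho> u * sin (\<kappa> * (t - u))) \<le> \<psi> u" if "0 < u" "u < t" for u
      using mult_mono [OF bd [OF that] abs_sin_le_one [of "\<kappa> * (t - u)"]] bd [OF that]
      by (simp add: abs_mult)
  qed
  then show ?thesis by (simp add: Y_def d0 B)
qed

text \<open>
The term \<open>(1 - t\<^sup>2) g\<close> is a perturbation of \<open>g'' + \<kappa>\<^sup>2 g = 0\<close>. A first use of \<open>oscillator_bound\<close>
shows \<open>g = cos \<kappa>t + O(1/\<kappa>)\<close>. Inserting this into the perturbation leaves the equation
\<open>a'' + \<kappa>\<^sup>2 a = - (1 - t\<^sup>2) cos \<kappa>t\<close>, which has an elementary solution, and a second use bounds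
\<open>g - a\<close> by \<open>O(1/\<kappa>\<^sup>2)\<close>.
\<close>

lemma perturbed_cos_approx:
  fixes g g' :: "real \<Rightarrow> real"
  assumes \<kappa>: "2 \<le> \<kappa>"
    and g: "\<And>t. (g has_real_derivative g' t) (at t)"
    and g': "\<And>t. (g' has_real_derivative - (\<kappa>\<^sup>2 + 1 - t\<^sup>2) * g t) (at t)"
    and g0: "g 0 = 1" "g' 0 = 0"
    and t: "0 \<le> t" "t \<le> 1"
  shows "\<bar>g t - (cos (\<kappa> * t) - (t - t ^ 3 / 3) / (2 * \<kappa>) * sin (\<kappa> * t))\<bar>
     \<le> (t\<^sup>2 / 2 + 9 / 16 * (t - t ^ 3 / 3)\<^sup>2) / \<kappa>\<^sup>2"
proof -
  have k0: "0 < \<kappa>" "\<kappa> \<noteq> 0" and k4: "4 \<le> \<kappa>\<^sup>2" using \<kappa> power_mono [of 2 \<kappa> 2] by auto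
  \<comment> \<open>The energy \<open>V\<close> decreases, since the stiffness \<open>\<kappa>\<^sup>2 + 1 - s\<^sup>2\<close> does.\<close>
  have g_le: "\<bar>g u\<bar> \<le> 9 / 8" if u: "0 \<le> u" "u \<le> 1" for u
  proof -
    define V where "V s = (\<kappa>\<^sup>2 + 1 - s\<^sup>2) * (g s)\<^sup>2 + (g' s)\<^sup>2" for s
    have "V u \<le> V 0"
    proof (rule DERIV_nonpos_imp_nonincreasing [OF u(1)])
      fix s assume s: "0 \<le> s" "s \<le> u"
      have "(V has_real_derivative - 2 * s * (g s)\<^sup>2) (at s)"
        unfolding V_def [abs_def]
        by (auto intro!: derivative_eq_intros g g') (simp add: algebra_simps power2_eq_square)
      then show "\<exists>y. (V has_real_derivative y) (at s) \<and> y \<le> 0"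
        using s by (intro exI [of _ "- 2 * s * (g s)\<^sup>2"]) simp
    qed
    then have "(\<kappa>\<^sup>2 + 1 - u\<^sup>2) * (g u)\<^sup>2 + (g' u)\<^sup>2 \<le> \<kappa>\<^sup>2 + 1"
      by (simp add: V_def g0)
    then have "(\<kappa>\<^sup>2 + 1 - u\<^sup>2) * (g u)\<^sup>2 \<le> \<kappa>\<^sup>2 + 1"
      using zero_le_power2 [of "g' u"] by linarith
    moreover have "\<kappa>\<^sup>2 * (g u)\<^sup>2 \<le> (\<kappa>\<^sup>2 + 1 - u\<^sup>2) * (g u)\<^sup>2"
      using u by (intro mult_right_mono) (auto simp: power_le_one)
    ultimately have "\<kappa>\<^sup>2 * (g u)\<^sup>2 \<le> \<kappa>\<^sup>2 * (5 / 4)" using k4 by simp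
    then have "(g u)\<^sup>2 \<le> 5 / 4" using k0 by simp
    also have "\<dots> \<le> (9 / 8)\<^sup>2" by (simp add: power2_eq_square)
    finally show ?thesis by (simp add: abs_le_square_iff [symmetric])
  qed
  have e1: "\<bar>\<kappa> * (g u - cos (\<kappa> * u))\<bar> \<le> 9 / 8 * (u - u ^ 3 / 3)" if u: "0 \<le> u" "u \<le> 1" for u
  proof (rule oscillator_bound [where d = "\<lambda>u. g u - cos (\<kappa> * u)"
        and d' = "\<lambda>u. g' u + \<kappa> * sin (\<kappa> * u)" and B = "\<lambda>u. 9 / 8 * (u - u ^ 3 / 3)"
        and \<rho> = "\<lambda>u. - (1 - u\<^sup>2) * g u" and \<psi> = "\<lambda>u. 9 / 8 * (1 - u\<^sup>2)"])
    fix s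
    show "((\<lambda>a. g a - cos (\<kappa> * a)) has_real_derivative g' s + \<kappa> * sin (\<kappa> * s)) (at s)"
      by (auto intro!: derivative_eq_intros g)
    show "((\<lambda>u. g' u + \<kappa> * sin (\<kappa> * u)) has_real_derivative
        - (1 - s\<^sup>2) * g s - \<kappa>\<^sup>2 * (g s - cos (\<kappa> * s))) (at s)"
      by (auto intro!: derivative_eq_intros g') (simp add: algebra_simps power2_eq_square)
    show "((\<lambda>a. 9 / 8 * (a - a ^ 3 / 3)) has_real_derivative 9 / 8 * (1 - s\<^sup>2)) (at s)"
      by (auto intro!: derivative_eq_intros)
    show "\<bar>- (1 - s\<^sup>2) * g s\<bar> \<le> 9 / 8 * (1 - s\<^sup>2)" if "0 < s" "s < u"
    proof -
      have "0 \<le> 1 - s\<^sup>2" using that u by (simp add: power_le_one)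
      then have "\<bar>- (1 - s\<^sup>2) * g s\<bar> = (1 - s\<^sup>2) * \<bar>g s\<bar>" by (simp add: abs_mult)
      also have "\<dots> \<le> (1 - s\<^sup>2) * (9 / 8)"
        using that u \<open>0 \<le> 1 - s\<^sup>2\<close> by (intro mult_left_mono g_le) auto
      finally show ?thesis by simp
    qed
  qed (use u g0 in auto)
  \<comment> \<open>The exact solution \<open>a\<close> is sought as \<open>p cos \<kappa>u + r sin \<kappa>u\<close> with polynomials \<open>p\<close> and \<open>r\<close>.
    The functions \<open>p'\<close> and \<open>r'\<close> are the coefficients of its derivative in the same form.\<close>
  define p where "p u = 1 + u\<^sup>2 / (4 * \<kappa>\<^sup>2)" for u
  define r where "r u = - ((u - u ^ 3 / 3) / (2 * \<kappa>)) - u / (4 * \<kappa> ^ 3)" for u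
  define p' where "p' u = u / (4 * \<kappa>\<^sup>2) - (u - u ^ 3 / 3) / 2" for u
  define r' where "r' u = - (1 - u\<^sup>2) / (2 * \<kappa>) - 1 / (4 * \<kappa> ^ 3) - \<kappa> - u\<^sup>2 / (4 * \<kappa>)" for u
  have dp: "(p has_real_derivative p' u - \<kappa> * r u) (at u)" for u
    unfolding p_def [abs_def] p'_def r_def using k0
    by (auto intro!: derivative_eq_intros simp: field_simps power2_eq_square power3_eq_cube)
  have dr: "(r has_real_derivative r' u + \<kappa> * p u) (at u)" for u
    unfolding p_def r'_def r_def [abs_def] using k0
    by (auto intro!: derivative_eq_intros simp: field_simps power2_eq_square power3_eq_cube)
  have dp': "(p' has_real_derivative - (1 - u\<^sup>2) - \<kappa>\<^sup>2 * p u - \<kappa> * r' u) (at u)" for u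
    unfolding p_def p'_def [abs_def] r'_def using k0
    by (auto intro!: derivative_eq_intros simp: field_simps power2_eq_square power3_eq_cube)
  have dr': "(r' has_real_derivative - \<kappa>\<^sup>2 * r u + \<kappa> * p' u) (at u)" for u
    unfolding r_def p'_def r'_def [abs_def] using k0
    by (auto intro!: derivative_eq_intros simp: field_simps power2_eq_square power3_eq_cube)
  define a where "a u = p u * cos (\<kappa> * u) + r u * sin (\<kappa> * u)" for u
  define a' where "a' u = p' u * cos (\<kappa> * u) + r' u * sin (\<kappa> * u)" for u
  have e2: "\<bar>\<kappa> * (g t - a t)\<bar> \<le> 9 / 16 * (t - t ^ 3 / 3)\<^sup>2 / \<kappa>"
  proof (rule oscillator_bound [where d = "\<lambda>u. g u - a u" and d' = "\<lambda>u. g' u - a' u"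
        and B = "\<lambda>u. 9 / 16 * (u - u ^ 3 / 3)\<^sup>2 / \<kappa>"
        and \<rho> = "\<lambda>u. - (1 - u\<^sup>2) * (g u - cos (\<kappa> * u))"
        and \<psi> = "\<lambda>u. (1 - u\<^sup>2) * (9 / 8 * (u - u ^ 3 / 3) / \<kappa>)"])
    fix s
    have "(a has_real_derivative a' s) (at s)"
      unfolding a_def [abs_def] a'_def
      by (auto intro!: derivative_eq_intros dp dr) (simp add: algebra_simps)
    then show "((\<lambda>u. g u - a u) has_real_derivative g' s - a' s) (at s)"
      by (intro DERIV_diff g)
    have "(a' has_real_derivative - (1 - s\<^sup>2) * cos (\<kappa> * s) - \<kappa>\<^sup>2 * a s) (at s)"
      unfolding a_def a'_def [abs_def]
      by (auto intro!: derivative_eq_intros dp' dr') (simp add: algebra_simps power2_eq_square)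
    from DERIV_diff [OF g' this]
    show "((\<lambda>u. g' u - a' u) has_real_derivative
        - (1 - s\<^sup>2) * (g s - cos (\<kappa> * s)) - \<kappa>\<^sup>2 * (g s - a s)) (at s)"
      by (rule DERIV_cong) (simp add: algebra_simps)
    show "((\<lambda>a. 9 / 16 * (a - a ^ 3 / 3)\<^sup>2 / \<kappa>) has_real_derivative
        (1 - s\<^sup>2) * (9 / 8 * (s - s ^ 3 / 3) / \<kappa>)) (at s)"
      by (auto intro!: derivative_eq_intros simp: k0)
    show "\<bar>- (1 - s\<^sup>2) * (g s - cos (\<kappa> * s))\<bar> \<le> (1 - s\<^sup>2) * (9 / 8 * (s - s ^ 3 / 3) / \<kappa>)"
      if "0 < s" "s < t"
    proof -
      have s: "0 \<le> 1 - s\<^sup>2" "0 \<le> s" "s \<le> 1" using that t by (auto simp: power_le_one)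
      have "\<bar>g s - cos (\<kappa> * s)\<bar> \<le> 9 / 8 * (s - s ^ 3 / 3) / \<kappa>"
        using e1 [OF s(2,3)] k0 by (simp add: abs_mult pos_le_divide_eq mult.commute)
      then have "(1 - s\<^sup>2) * \<bar>g s - cos (\<kappa> * s)\<bar> \<le> (1 - s\<^sup>2) * (9 / 8 * (s - s ^ 3 / 3) / \<kappa>)"
        by (rule mult_left_mono [OF _ s(1)])
      moreover have "\<bar>- (1 - s\<^sup>2)\<bar> = 1 - s\<^sup>2" using s(1) by simp
      ultimately show ?thesis unfolding abs_mult by simp
    qed
  qed (use t g0 in \<open>auto simp: a_def a'_def p_def r_def p'_def\<close>)
  have "\<bar>\<kappa> * (g t - a t)\<bar> = \<kappa> * \<bar>g t - a t\<bar>" using k0 by (simp add: abs_mult)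
  then have "\<kappa> * (\<kappa> * \<bar>g t - a t\<bar>) \<le> 9 / 16 * (t - t ^ 3 / 3)\<^sup>2"
    using e2 k0(1) by (simp only: pos_le_divide_eq mult.commute)
  then have "\<bar>g t - a t\<bar> \<le> 9 / 16 * (t - t ^ 3 / 3)\<^sup>2 / \<kappa>\<^sup>2"
    using k0(1) by (subst pos_le_divide_eq) (simp_all add: mult_ac power2_eq_square [of \<kappa>])
  moreover have "\<bar>a t - (cos (\<kappa> * t) - (t - t ^ 3 / 3) / (2 * \<kappa>) * sin (\<kappa> * t))\<bar> \<le> t\<^sup>2 / 2 / \<kappa>\<^sup>2"
  proof -
    have 1: "\<bar>t\<^sup>2 / (4 * \<kappa>\<^sup>2) * cos (\<kappa> * t)\<bar> \<le> t\<^sup>2 / (4 * \<kappa>\<^sup>2)"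
      using mult_left_mono [OF abs_cos_le_one [of "\<kappa> * t"], of "t\<^sup>2 / (4 * \<kappa>\<^sup>2)"] by (simp add: abs_mult)
    \<comment> \<open>By \<open>\<bar>sin x\<bar> \<le> \<bar>x\<bar>\<close> the term of order \<open>\<kappa>\<^sup>-\<^sup>3\<close> also fits under \<open>t\<^sup>2/(4\<kappa>\<^sup>2)\<close>.\<close>
    have 2: "\<bar>t / (4 * \<kappa> ^ 3) * sin (\<kappa> * t)\<bar> \<le> t / (4 * \<kappa> ^ 3) * (\<kappa> * t)"
      using mult_left_mono [OF abs_sin_x_le_abs_x [of "\<kappa> * t"], of "t / (4 * \<kappa> ^ 3)"] k0 t
      by (simp add: abs_mult)
    have 3: "t / (4 * \<kappa> ^ 3) * (\<kappa> * t) = t\<^sup>2 / (4 * \<kappa>\<^sup>2)"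
      using k0 by (simp add: field_simps power2_eq_square power3_eq_cube)
    have "a t - (cos (\<kappa> * t) - (t - t ^ 3 / 3) / (2 * \<kappa>) * sin (\<kappa> * t))
       = t\<^sup>2 / (4 * \<kappa>\<^sup>2) * cos (\<kappa> * t) - t / (4 * \<kappa> ^ 3) * sin (\<kappa> * t)"
      by (simp add: a_def p_def r_def distrib_right left_diff_distrib)
    then have "\<bar>a t - (cos (\<kappa> * t) - (t - t ^ 3 / 3) / (2 * \<kappa>) * sin (\<kappa> * t))\<bar>
       \<le> \<bar>t\<^sup>2 / (4 * \<kappa>\<^sup>2) * cos (\<kappa> * t)\<bar> + \<bar>t / (4 * \<kappa> ^ 3) * sin (\<kappa> * t)\<bar>"
      by (simp only: abs_triangle_ineq4)
    also have "\<dots> \<le> t\<^sup>2 / (4 * \<kappa>\<^sup>2) + t\<^sup>2 / (4 * \<kappa>\<^sup>2)"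
      using add_mono [OF 1 2] unfolding 3 .
    also have "t\<^sup>2 / (4 * \<kappa>\<^sup>2) + t\<^sup>2 / (4 * \<kappa>\<^sup>2) = t\<^sup>2 / 2 / \<kappa>\<^sup>2" by simp
    finally show ?thesis .
  qed
  ultimately show ?thesis unfolding add_divide_distrib by linarith
qed

section \<open>Tails of Bessel type equations\<close>

text \<open>
A function whose derivative is dominated beyond \<open>z\<close> differs from its limit at infinity by at most
the integral \<open>\<Phi>(z)\<close> of the majorant. Stating this with an explicit \<open>\<Phi>\<close> avoids improper integrals.
\<close>

lemma limit_minus_value_le:
  fixes D D' \<Phi> \<psi> :: "real \<Rightarrow> real"
  assumes D: "\<And>w. z \<le> w \<Longrightarrow> (D has_real_derivative D' w) (at w)"
    and \<Phi>: "\<And>w. z \<le> w \<Longrightarrow> (\<Phi> has_real_derivative - \<psi> w) (at w)"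
    and le: "\<And>w. z \<le> w \<Longrightarrow> \<bar>D' w\<bar> \<le> \<psi> w"
    and lim: "(D \<longlongrightarrow> l) at_top" "(\<Phi> \<longlongrightarrow> 0) at_top"
  shows "\<bar>l - D z\<bar> \<le> \<Phi> z"
proof (rule tendsto_le)
  show "((\<lambda>w. \<bar>D w - D z\<bar>) \<longlongrightarrow> \<bar>l - D z\<bar>) at_top" "((\<lambda>w. \<Phi> z - \<Phi> w) \<longlongrightarrow> \<Phi> z) at_top"
    using lim by (auto intro!: tendsto_eq_intros)
  show "\<forall>\<^sub>F w in at_top. \<bar>D w - D z\<bar> \<le> \<Phi> z - \<Phi> w"
  proof (rule eventually_mono [OF eventually_gt_at_top [of z]])
    fix w assume w: "z < w"
    have "norm (D w - D z) \<le> - \<Phi> w - - \<Phi> z"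
    proof (rule differentiable_bound_general [OF w])
      show "continuous_on {z..w} D" "continuous_on {z..w} (\<lambda>w. - \<Phi> w)"
        by (auto intro!: continuous_at_imp_continuous_on continuous_minus DERIV_isCont [OF D] DERIV_isCont [OF \<Phi>])
      show "(D has_vector_derivative D' u) (at u)" if "z < u" for u
        using D that by (simp add: has_real_derivative_iff_has_vector_derivative)
      show "((\<lambda>w. - \<Phi> w) has_vector_derivative \<psi> u) (at u)" if "z < u" for u
        using DERIV_minus [OF \<Phi> [of u]] that by (simp add: has_real_derivative_iff_has_vector_derivative)
      show "norm (D' u) \<le> \<psi> u" if "z < u" for u using le that by simp
    qed
    then show "\<bar>D w - D z\<bar> \<le> \<Phi> z - \<Phi> w" by simp
  qed
qed simp

lemma abs_mult_bounded_le: "\<bar>a * x\<bar> \<le> a" if "\<bar>x\<bar> \<le> 1" "0 \<le> a" for a x :: real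
  using mult_left_mono [OF that] that by (simp add: abs_mult)

lemma abs_mult_bounded_mult_le: "\<bar>a * x * y\<bar> \<le> a * \<bar>y\<bar>" if "\<bar>x\<bar> \<le> 1" "0 \<le> a" for a x y :: real
proof -
  have "\<bar>a * x * y\<bar> = a * (\<bar>x\<bar> * \<bar>y\<bar>)" using that by (simp add: abs_mult)
  also have "\<dots> \<le> a * (1 * \<bar>y\<bar>)" using that by (intro mult_left_mono mult_right_mono) auto
  finally show ?thesis by simp
qed

lemma const_over_at_top: "((\<lambda>w::real. c / w) \<longlongrightarrow> 0) at_top" for c :: real
  by (rule tendsto_divide_0 [OF tendsto_const]) (simp add: filterlim_at_top_imp_at_infinity filterlim_ident)

lemma const_over_square_at_top: "((\<lambda>w::real. c / w\<^sup>2) \<longlongrightarrow> 0) at_top" for c :: real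
  using tendsto_mult [OF const_over_at_top [of c] const_over_at_top [of 1]] by (simp add: power2_eq_square)

text \<open>
Variation of constants from infinity for \<open>j'' + (1 + 1/(4w\<^sup>2)) j = 0\<close>, where the leading behaviour is
assumed. For fixed \<open>\<beta>\<close> the combination \<open>Y\<^sub>\<beta>(w) = j'(w) sin(\<beta> - w) + j(w) cos(\<beta> - w)\<close> would be
constant for solutions of \<open>j'' + j = 0\<close>. Here its derivative is \<open>- j(w) sin(\<beta> - w) / (4w\<^sup>2)\<close>, which
is integrable at infinity. The choice \<open>\<beta> = z\<close> recovers \<open>j(z)\<close> and \<open>\<beta> = z + \<pi>/2\<close> recovers \<open>j'(z)\<close>.
The second order term comes from inserting the first order result into this derivative.
\<close>

lemma Bessel_type_asymptotics:
  fixes j j' :: "real \<Rightarrow> real"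
  assumes j: "\<And>w. 0 < w \<Longrightarrow> (j has_real_derivative j' w) (at w)"
    and j': "\<And>w. 0 < w \<Longrightarrow> (j' has_real_derivative - (1 + 1 / (4 * w\<^sup>2)) * j w) (at w)"
    and lim: "((\<lambda>w. j w - \<alpha> * cos (w - pi / 4)) \<longlongrightarrow> 0) at_top"
      "((\<lambda>w. j' w + \<alpha> * sin (w - pi / 4)) \<longlongrightarrow> 0) at_top"
    and \<alpha>: "0 \<le> \<alpha>" and z: "0 < z"
  shows "\<bar>j z\<bar> \<le> \<alpha>"
    and "\<bar>j' z + \<alpha> * sin (z - pi / 4)\<bar> \<le> \<alpha> / (4 * z)"
    and "\<bar>j z - (\<alpha> * cos (z - pi / 4) + \<alpha> / (8 * z) * sin (z - pi / 4))\<bar> \<le> 5 * \<alpha> / (32 * z\<^sup>2)"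
proof -
  \<comment> \<open>The energy \<open>V = j\<^sup>2 + j'\<^sup>2/q\<close> with the stiffness \<open>q = 1 + 1/(4w\<^sup>2)\<close> increases, as \<open>q\<close> decreases,
    and its limit is \<open>\<alpha>\<^sup>2\<close>. The factor \<open>r\<close> below is \<open>1/q\<close>.\<close>
  have j_le: "\<bar>j z\<bar> \<le> \<alpha>" if z: "0 < z" for z
  proof -
    define r where "r w = 1 - 1 / (4 * w\<^sup>2 + 1)" for w :: real
    define V where "V w = (j w)\<^sup>2 + r w * (j' w)\<^sup>2" for w
    have pos: "4 * w\<^sup>2 + 1 > 0" for w :: real using zero_le_power2 [of w] by linarith
    have V_mono: "V z \<le> V w" if "z \<le> w" for w
    proof (rule DERIV_nonneg_imp_nondecreasing [OF that])
      fix s assume "z \<le> s" "s \<le> w"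
      then have s: "0 < s" using z by simp
      have ne: "4 * s\<^sup>2 + 1 \<noteq> 0" using pos [of s] by simp
      define q where "q = 1 + 1 / (4 * s\<^sup>2)"
      define r' where "r' = 8 * s / (4 * s\<^sup>2 + 1)\<^sup>2"
      have rq: "r s * q = 1"
      proof -
        have "r s = 4 * s\<^sup>2 / (4 * s\<^sup>2 + 1)" using ne by (simp add: r_def divide_simps)
        moreover have "q = (4 * s\<^sup>2 + 1) / (4 * s\<^sup>2)" using s by (simp add: q_def add_divide_distrib)
        ultimately show ?thesis using ne s by simp
      qed
      have dr: "(r has_real_derivative r') (at s)"
        unfolding r_def [abs_def] r'_def using ne
        by (auto intro!: derivative_eq_intros simp: power2_eq_square)
      have dj': "(j' has_real_derivative - q * j s) (at s)" using j' [OF s] by (simp add: q_def)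
      have dV: "(V has_real_derivative
          2 * j s * j' s + (r' * (j' s)\<^sup>2 + r s * (2 * j' s * (- q * j s)))) (at s)"
        unfolding V_def [abs_def]
        by (auto intro!: derivative_eq_intros j s dr dj')
      have "r s * (2 * j' s * (- q * j s)) = - (r s * q) * (2 * j s * j' s)" by (simp add: algebra_simps)
      then have "r s * (2 * j' s * (- q * j s)) = - (2 * j s * j' s)" unfolding rq by simp
      with dV have "(V has_real_derivative r' * (j' s)\<^sup>2) (at s)" by (simp only:) simp
      then show "\<exists>y. (V has_real_derivative y) (at s) \<and> 0 \<le> y"
        using s by (intro exI [of _ "r' * (j' s)\<^sup>2"]) (simp add: r'_def)
    qed
    define N where "N w = (j w)\<^sup>2 + (j' w)\<^sup>2" for w
    have "V z \<le> \<alpha>\<^sup>2"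
    proof (rule tendsto_lowerbound)
      define e1 e2 where "e1 w = j w - \<alpha> * cos (w - pi / 4)"
        and "e2 w = j' w + \<alpha> * sin (w - pi / 4)" for w
      have e: "(e1 \<longlongrightarrow> 0) at_top" "(e2 \<longlongrightarrow> 0) at_top"
        using lim by (simp_all add: e1_def [abs_def] e2_def [abs_def])
      have eq: "N w - \<alpha>\<^sup>2 = 2 * \<alpha> * cos (w - pi / 4) * e1 w - 2 * \<alpha> * sin (w - pi / 4) * e2 w + (e1 w)\<^sup>2 + (e2 w)\<^sup>2" for w
      proof -
        have "\<alpha>\<^sup>2 = (\<alpha> * cos (w - pi / 4))\<^sup>2 + (\<alpha> * sin (w - pi / 4))\<^sup>2"
          by (simp add: power_mult_distrib flip: distrib_left)
        then show ?thesis by (simp add: N_def e1_def e2_def power2_eq_square algebra_simps)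
      qed
      have N_le: "\<bar>N w - \<alpha>\<^sup>2\<bar> \<le> 2 * \<alpha> * \<bar>e1 w\<bar> + 2 * \<alpha> * \<bar>e2 w\<bar> + (e1 w)\<^sup>2 + (e2 w)\<^sup>2" for w
      proof -
        have "\<bar>2 * \<alpha> * cos (w - pi / 4) * e1 w\<bar> \<le> 2 * \<alpha> * \<bar>e1 w\<bar>"
          "\<bar>2 * \<alpha> * sin (w - pi / 4) * e2 w\<bar> \<le> 2 * \<alpha> * \<bar>e2 w\<bar>"
          using \<alpha> by (auto intro!: abs_mult_bounded_mult_le)
        then show ?thesis unfolding eq using zero_le_power2 [of "e1 w"] zero_le_power2 [of "e2 w"] by linarith
      qed
      have "((\<lambda>w. 2 * \<alpha> * \<bar>e1 w\<bar> + 2 * \<alpha> * \<bar>e2 w\<bar> + (e1 w)\<^sup>2 + (e2 w)\<^sup>2) \<longlongrightarrow> 0) at_top"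
        using e by (auto intro!: tendsto_eq_intros)
      then have "((\<lambda>w. N w - \<alpha>\<^sup>2) \<longlongrightarrow> 0) at_top"
        by (rule Lim_null_comparison [rotated]) (intro always_eventually allI, unfold real_norm_def, rule N_le)
      then show "(N \<longlongrightarrow> \<alpha>\<^sup>2) at_top" by (simp add: LIM_zero_iff)
      show "\<forall>\<^sub>F w in at_top. V z \<le> N w"
      proof (rule eventually_mono [OF eventually_ge_at_top [of z]])
        fix w assume "z \<le> w"
        then have "V z \<le> V w" by (rule V_mono)
        also have "\<dots> \<le> N w" using pos [of w] by (simp add: V_def N_def r_def left_diff_distrib)
        finally show "V z \<le> N w" .
      qed
    qed simp
    moreover have "(j z)\<^sup>2 \<le> V z" using pos [of z] by (simp add: V_def r_def)
    ultimately have "(j z)\<^sup>2 \<le> \<alpha>\<^sup>2" by linarith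
    then show ?thesis using \<alpha> by (simp add: abs_le_square_iff [symmetric])
  qed
  then show "\<bar>j z\<bar> \<le> \<alpha>" using z .
  define Y where "Y \<beta> w = j' w * sin (\<beta> - w) + j w * cos (\<beta> - w)" for \<beta> w
  have Y: "(Y \<beta> has_real_derivative - (j w / (4 * w\<^sup>2)) * sin (\<beta> - w)) (at w)" if "0 < w" for \<beta> w
    unfolding Y_def [abs_def]
    by (auto intro!: derivative_eq_intros j j' that) (simp add: algebra_simps)
  have Y_lim: "(Y \<beta> \<longlongrightarrow> \<alpha> * cos (\<beta> - pi / 4)) at_top" for \<beta>
  proof -
    define e1 e2 where "e1 w = j w - \<alpha> * cos (w - pi / 4)"
      and "e2 w = j' w + \<alpha> * sin (w - pi / 4)" for w
    have e: "(e1 \<longlongrightarrow> 0) at_top" "(e2 \<longlongrightarrow> 0) at_top"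
      using lim by (simp_all add: e1_def [abs_def] e2_def [abs_def])
    have eq: "Y \<beta> w - \<alpha> * cos (\<beta> - pi / 4) = e2 w * sin (\<beta> - w) + e1 w * cos (\<beta> - w)" for w
    proof -
      have "cos (\<beta> - pi / 4) = cos ((w - pi / 4) + (\<beta> - w))" by simp
      also have "\<dots> = cos (w - pi / 4) * cos (\<beta> - w) - sin (w - pi / 4) * sin (\<beta> - w)"
        by (rule cos_add)
      finally have c: "cos (\<beta> - pi / 4) = cos (w - pi / 4) * cos (\<beta> - w) - sin (w - pi / 4) * sin (\<beta> - w)" .
      show ?thesis unfolding c by (simp add: Y_def e1_def e2_def algebra_simps)
    qed
    have Y_le: "\<bar>Y \<beta> w - \<alpha> * cos (\<beta> - pi / 4)\<bar> \<le> \<bar>e2 w\<bar> + \<bar>e1 w\<bar>" for w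
    proof -
      have "\<bar>e2 w * sin (\<beta> - w)\<bar> \<le> \<bar>e2 w\<bar>" "\<bar>e1 w * cos (\<beta> - w)\<bar> \<le> \<bar>e1 w\<bar>"
        by (auto simp: abs_mult intro!: mult_left_le)
      then show ?thesis unfolding eq by linarith
    qed
    have "((\<lambda>w. \<bar>e2 w\<bar> + \<bar>e1 w\<bar>) \<longlongrightarrow> 0) at_top"
      using e by (auto intro!: tendsto_eq_intros)
    then have "((\<lambda>w. Y \<beta> w - \<alpha> * cos (\<beta> - pi / 4)) \<longlongrightarrow> 0) at_top"
      by (rule Lim_null_comparison [rotated]) (intro always_eventually allI, unfold real_norm_def, rule Y_le)
    then show ?thesis by (simp add: LIM_zero_iff)
  qed
  have Y_bound: "\<bar>\<alpha> * cos (\<beta> - pi / 4) - Y \<beta> z\<bar> \<le> \<alpha> / (4 * z)" if z: "0 < z" for \<beta> z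
  proof (rule limit_minus_value_le [where D = "Y \<beta>" and D' = "\<lambda>w. - (j w / (4 * w\<^sup>2)) * sin (\<beta> - w)"
        and \<Phi> = "\<lambda>a. \<alpha> / (4 * a)" and \<psi> = "\<lambda>w. \<alpha> / (4 * w\<^sup>2)"])
    fix w assume "z \<le> w"
    then have w: "0 < w" using z by simp
    show "(Y \<beta> has_real_derivative - (j w / (4 * w\<^sup>2)) * sin (\<beta> - w)) (at w)" by (rule Y [OF w])
    show "((\<lambda>a. \<alpha> / (4 * a)) has_real_derivative - (\<alpha> / (4 * w\<^sup>2))) (at w)"
      using w by (auto intro!: derivative_eq_intros simp: power2_eq_square)
    have "\<bar>- (j w / (4 * w\<^sup>2)) * sin (\<beta> - w)\<bar> \<le> \<bar>j w\<bar> / (4 * w\<^sup>2) * 1"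
      unfolding abs_mult by (intro mult_mono) auto
    also have "\<dots> \<le> \<alpha> / (4 * w\<^sup>2)" using j_le [OF w] by (simp add: divide_right_mono)
    finally show "\<bar>- (j w / (4 * w\<^sup>2)) * sin (\<beta> - w)\<bar> \<le> \<alpha> / (4 * w\<^sup>2)" .
  next
    show "(Y \<beta> \<longlongrightarrow> \<alpha> * cos (\<beta> - pi / 4)) at_top" by (rule Y_lim)
    show "((\<lambda>a. \<alpha> / (4 * a)) \<longlongrightarrow> 0) at_top" using const_over_at_top [of "\<alpha> / 4"] by simp
  qed
  have "cos (z + pi / 2 - pi / 4) = - sin (z - pi / 4)"
    using cos_add [of "z - pi / 4" "pi / 2"] by (simp add: algebra_simps)
  then show "\<bar>j' z + \<alpha> * sin (z - pi / 4)\<bar> \<le> \<alpha> / (4 * z)"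
    using Y_bound [OF z, of "z + pi / 2"] by (simp add: Y_def)
  \<comment> \<open>With \<open>j(w)\<close> replaced by \<open>\<alpha> cos(w - \<pi>/4)\<close>, the derivative of \<open>Y\<^sub>z\<close> splits into a monotone and an
    oscillating part. \<open>P\<close> is a primitive up to \<open>O(w\<^sup>-\<^sup>3)\<close>: the monotone part yields the second order
    term, the oscillating part gains a further power of \<open>w\<close>.\<close>
  define A where "A w = \<alpha> / (8 * w)" for w
  define B where "B w = \<alpha> / (16 * w\<^sup>2)" for w
  define P where "P w = A w * sin (z - pi / 4) - B w * cos (2 * w - z - pi / 4)" for w
  define q where "q w = 1 / (4 * w\<^sup>2)" for w :: real
  define P' where "P' w = - (\<alpha> * q w / 2) * (sin (z - pi / 4) - sin (2 * w - z - pi / 4))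
      + \<alpha> / (8 * w ^ 3) * cos (2 * w - z - pi / 4)" for w
  have P: "(P has_real_derivative P' w) (at w)" if "0 < w" for w
  proof -
    have A: "(A has_real_derivative - (\<alpha> * q w / 2)) (at w)"
      unfolding A_def [abs_def] using that by (auto intro!: derivative_eq_intros simp: q_def power2_eq_square)
    have B: "(B has_real_derivative - (\<alpha> / (8 * w ^ 3))) (at w)"
      unfolding B_def [abs_def] using that
      by (auto intro!: derivative_eq_intros simp: field_simps power2_eq_square power3_eq_cube)
    have Bq: "B w = \<alpha> * q w / 4" by (simp add: B_def q_def)
    have "(P has_real_derivative - (\<alpha> * q w / 2) * sin (z - pi / 4)
        - (- (\<alpha> / (8 * w ^ 3)) * cos (2 * w - z - pi / 4) - B w * (2 * sin (2 * w - z - pi / 4)))) (at w)"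
      unfolding P_def [abs_def] by (auto intro!: derivative_eq_intros A B)
    then show ?thesis unfolding P'_def Bq by (simp add: algebra_simps)
  qed
  have "\<bar>\<alpha> * cos (z - pi / 4) - (Y z z - P z)\<bar> \<le> 3 * \<alpha> / (32 * z\<^sup>2)"
  proof (rule limit_minus_value_le [where D = "\<lambda>w. Y z w - P w" and D' = "\<lambda>w. - (q w * j w) * sin (z - w) - P' w"
        and \<Phi> = "\<lambda>a. 3 * \<alpha> / (32 * a\<^sup>2)" and \<psi> = "\<lambda>w. 3 * \<alpha> / (16 * w ^ 3)"])
    fix w assume "z \<le> w"
    then have w: "0 < w" using z by simp
    show "((\<lambda>w. Y z w - P w) has_real_derivative - (q w * j w) * sin (z - w) - P' w) (at w)"
      using DERIV_diff [OF Y [OF w, of z] P [OF w]] by (simp add: q_def)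
    show "((\<lambda>a. 3 * \<alpha> / (32 * a\<^sup>2)) has_real_derivative - (3 * \<alpha> / (16 * w ^ 3))) (at w)"
      using w by (auto intro!: derivative_eq_intros simp: field_simps power2_eq_square power3_eq_cube)
    have "\<bar>j w - \<alpha> * cos (w - pi / 4)\<bar> \<le> \<alpha> / (4 * w)"
      using Y_bound [OF w, of w] by (simp add: Y_def abs_minus_commute)
    moreover have "2 * (cos (w - pi / 4) * sin (z - w)) = sin (z - pi / 4) - sin (2 * w - z - pi / 4)"
      using sin_diff [of "w - pi / 4" "z - w"] sin_add [of "w - pi / 4" "z - w"]
      by (simp add: algebra_simps)
    then have "\<alpha> * q w / 2 * (sin (z - pi / 4) - sin (2 * w - z - pi / 4))
        = q w * (\<alpha> * cos (w - pi / 4)) * sin (z - w)" by (simp flip: \<open>2 * _ = _\<close>)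
    then have "- (q w * j w) * sin (z - w) - P' w
      = - (q w * (j w - \<alpha> * cos (w - pi / 4))) * sin (z - w) - \<alpha> / (8 * w ^ 3) * cos (2 * w - z - pi / 4)"
      unfolding P'_def by (simp add: left_diff_distrib right_diff_distrib)
    moreover have "\<bar>- (q w * (j w - \<alpha> * cos (w - pi / 4))) * sin (z - w)\<bar> \<le> q w * (\<alpha> / (4 * w)) * 1"
      unfolding abs_mult abs_minus_cancel using calculation(1) w
      by (intro mult_mono) (use \<alpha> in \<open>auto simp: q_def\<close>)
    moreover have "\<bar>\<alpha> / (8 * w ^ 3) * cos (2 * w - z - pi / 4)\<bar> \<le> \<alpha> / (8 * w ^ 3)"
      using \<alpha> w by (intro abs_mult_bounded_le) auto
    moreover have "q w * (\<alpha> / (4 * w)) * 1 + \<alpha> / (8 * w ^ 3) = 3 * \<alpha> / (16 * w ^ 3)"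
      using w by (simp add: q_def field_simps power2_eq_square power3_eq_cube)
    ultimately show "\<bar>- (q w * j w) * sin (z - w) - P' w\<bar> \<le> 3 * \<alpha> / (16 * w ^ 3)"
      by linarith
  next
    have "(P \<longlongrightarrow> 0) at_top"
    proof (rule Lim_null_comparison)
      show "\<forall>\<^sub>F w in at_top. norm (P w) \<le> \<alpha> / 8 / w + \<alpha> / 16 / w\<^sup>2"
      proof (rule eventually_mono [OF eventually_gt_at_top [of 0]])
        fix w :: real assume w: "0 < w"
        have "\<bar>A w * sin (z - pi / 4)\<bar> \<le> \<alpha> / 8 / w"
          "\<bar>B w * cos (2 * w - z - pi / 4)\<bar> \<le> \<alpha> / 16 / w\<^sup>2"
          using \<alpha> w abs_mult_bounded_le [of "sin (z - pi / 4)" "A w"] abs_mult_bounded_le [of "cos (2 * w - z - pi / 4)" "B w"]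
          by (auto simp: A_def B_def)
        then show "norm (P w) \<le> \<alpha> / 8 / w + \<alpha> / 16 / w\<^sup>2" unfolding P_def real_norm_def by linarith
      qed
      show "((\<lambda>w. \<alpha> / 8 / w + \<alpha> / 16 / w\<^sup>2) \<longlongrightarrow> 0) at_top"
        using tendsto_add [OF const_over_at_top [of "\<alpha> / 8"] const_over_square_at_top [of "\<alpha> / 16"]] by simp
    qed
    then show "((\<lambda>w. Y z w - P w) \<longlongrightarrow> \<alpha> * cos (z - pi / 4)) at_top"
      using tendsto_diff [OF Y_lim [of z]] by fastforce
    show "((\<lambda>a. 3 * \<alpha> / (32 * a\<^sup>2)) \<longlongrightarrow> 0) at_top" using const_over_square_at_top [of "3 * \<alpha> / 32"] by simp
  qed
  moreover have "\<bar>\<alpha> / (16 * z\<^sup>2) * cos (z - pi / 4)\<bar> \<le> \<alpha> / (16 * z\<^sup>2)"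
    using \<alpha> by (intro abs_mult_bounded_le) auto
  moreover have "\<alpha> * cos (z - pi / 4) - (Y z z - P z) =
     - (j z - (\<alpha> * cos (z - pi / 4) + \<alpha> / (8 * z) * sin (z - pi / 4))) - \<alpha> / (16 * z\<^sup>2) * cos (z - pi / 4)"
    by (simp add: Y_def P_def A_def B_def)
  moreover have "3 * \<alpha> / (32 * z\<^sup>2) + \<alpha> / (16 * z\<^sup>2) = 5 * \<alpha> / (32 * z\<^sup>2)"
    using z by (simp add: field_simps)
  ultimately show "\<bar>j z - (\<alpha> * cos (z - pi / 4) + \<alpha> / (8 * z) * sin (z - pi / 4))\<bar> \<le> 5 * \<alpha> / (32 * z\<^sup>2)"
    by linarith
qed

section \<open>The Fresnel integral\<close>

lemma cis_has_vector_derivative: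
  assumes "(f has_real_derivative d) (at x within A)"
  shows "((\<lambda>x. cis (f x)) has_vector_derivative of_real d * (\<i> * cis (f x))) (at x within A)"
proof -
  have "(f has_derivative (\<lambda>t. d * t)) (at x within A)"
    using assms by (simp add: has_field_derivative_def)
  from has_derivative_cis [OF this] show ?thesis
    unfolding has_vector_derivative_def by (rule has_derivative_eq_rhs) (auto simp: scaleR_conv_of_real mult_ac)
qed

text \<open>
The Fresnel integrals in complex form. Their limit is found by the device that is used for the
Gaussian integral: the square of \<open>fresnel\<close> and \<open>\<i>\<close> times the auxiliary integral have the same
derivative.
\<close>

definition fresnel :: "real \<Rightarrow> complex" where
  "fresnel x = integral {0..x} (\<lambda>w. cis (- w\<^sup>2))"

definition fresnel_aux :: "real \<Rightarrow> complex" where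
  "fresnel_aux x = integral {0..1} (\<lambda>t. of_real (1 / (1 + t\<^sup>2)) * cis (- (x\<^sup>2 * (1 + t\<^sup>2))))"

lemma fresnel_0 [simp]: "fresnel 0 = 0"
  by (simp add: fresnel_def)

lemma fresnel_has_vector_derivative:
  "0 \<le> x \<Longrightarrow> x \<le> T \<Longrightarrow> (fresnel has_vector_derivative cis (- x\<^sup>2)) (at x within {0..T})"
  unfolding fresnel_def [abs_def]
  by (rule integral_has_vector_derivative) (auto intro!: continuous_intros)

lemma one_plus_square_neq_0: "1 + t\<^sup>2 \<noteq> 0" for t :: real
  using zero_le_power2 [of t] by linarith

lemma fresnel_mult_has_vector_derivative:
  assumes "0 \<le> x" "t \<in> {0..1}"
  shows "((\<lambda>t. fresnel (x * t)) has_vector_derivative of_real x * cis (- (x * t)\<^sup>2)) (at t within {0..1})"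
proof -
  have "((\<lambda>t. x * t) has_vector_derivative x) (at t within {0..1})"
    by (auto intro!: derivative_eq_intros)
  moreover have "(fresnel has_vector_derivative cis (- (x * t)\<^sup>2)) (at (x * t) within (\<lambda>t. x * t) ` {0..1})"
    by (rule has_vector_derivative_within_subset [OF fresnel_has_vector_derivative [where T = x]])
      (use assms in \<open>auto simp: mult_left_le\<close>)
  ultimately show ?thesis
    using vector_diff_chain_within by (fastforce simp: scaleR_conv_of_real o_def)
qed

lemma fresnel_scaled:
  assumes "0 \<le> x"
  shows "((\<lambda>t. of_real x * cis (- (x * t)\<^sup>2)) has_integral fresnel x) {0..1}"
proof -
  have "((\<lambda>t. of_real x * cis (- (x * t)\<^sup>2)) has_integral fresnel (x * 1) - fresnel (x * 0)) {0..1}"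
    by (rule fundamental_theorem_of_calculus) (auto intro!: fresnel_mult_has_vector_derivative assms)
  then show ?thesis by simp
qed

lemma fresnel_aux_0: "fresnel_aux 0 = of_real (pi / 4)"
proof -
  have "((\<lambda>t. 1 / (1 + t\<^sup>2)) has_integral arctan 1 - arctan 0) {0..1::real}"
    by (rule fundamental_theorem_of_calculus)
      (auto intro!: derivative_eq_intros simp: has_real_derivative_iff_has_vector_derivative [symmetric] divide_inverse)
  from has_integral_linear [OF this bounded_linear_of_real [where 'a = complex]]
  have "((\<lambda>t. of_real (1 / (1 + t\<^sup>2)) :: complex) has_integral of_real (pi / 4)) {0..1::real}"
    by (simp add: o_def arctan_one)
  then show ?thesis unfolding fresnel_aux_def by (simp add: integral_unique)
qed

lemma fresnel_aux_has_vector_derivative: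
  assumes "0 \<le> x"
  shows "(fresnel_aux has_vector_derivative - 2 * \<i> * cis (- x\<^sup>2) * fresnel x) (at x)"
proof -
  have "((\<lambda>x. integral (cbox 0 1) (\<lambda>t. of_real (1 / (1 + t\<^sup>2)) * cis (- (x\<^sup>2 * (1 + t\<^sup>2)))))
     has_vector_derivative integral (cbox 0 1) (\<lambda>t. - 2 * \<i> * of_real x * cis (- (x\<^sup>2 * (1 + t\<^sup>2))))) (at x within UNIV)"
  proof (rule leibniz_rule_vector_derivative)
    fix x t :: real
    have "((\<lambda>x. cis (- (x\<^sup>2 * (1 + t\<^sup>2)))) has_vector_derivative
        of_real (- 2 * x * (1 + t\<^sup>2)) * (\<i> * cis (- (x\<^sup>2 * (1 + t\<^sup>2))))) (at x)"
      by (rule cis_has_vector_derivative) (auto intro!: derivative_eq_intros)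
    then have "((\<lambda>x. of_real (1 / (1 + t\<^sup>2)) * cis (- (x\<^sup>2 * (1 + t\<^sup>2)))) has_vector_derivative
        of_real (1 / (1 + t\<^sup>2)) * (of_real (- 2 * x * (1 + t\<^sup>2)) * (\<i> * cis (- (x\<^sup>2 * (1 + t\<^sup>2)))))) (at x)"
      by (rule has_vector_derivative_mult_right)
    moreover have "of_real (1 / (1 + t\<^sup>2)) * (of_real (- 2 * x * (1 + t\<^sup>2)) * (\<i> * cis (- (x\<^sup>2 * (1 + t\<^sup>2)))))
        = - 2 * \<i> * of_real x * cis (- (x\<^sup>2 * (1 + t\<^sup>2)))"
    proof -
      have "1 / (1 + t\<^sup>2) * (- 2 * x * (1 + t\<^sup>2)) = - 2 * x"
        using one_plus_square_neq_0 [of t] by simp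
      then have "of_real (1 / (1 + t\<^sup>2)) * of_real (- 2 * x * (1 + t\<^sup>2)) = (of_real (- 2 * x) :: complex)"
        by (simp only: of_real_mult [symmetric])
      then show ?thesis by (simp only: mult.assoc [symmetric]) simp
    qed
    ultimately show "((\<lambda>x. of_real (1 / (1 + t\<^sup>2)) * cis (- (x\<^sup>2 * (1 + t\<^sup>2)))) has_vector_derivative
        - 2 * \<i> * of_real x * cis (- (x\<^sup>2 * (1 + t\<^sup>2)))) (at x within UNIV)" by (simp only:)
  next
    fix x :: real
    show "(\<lambda>t. of_real (1 / (1 + t\<^sup>2)) * cis (- (x\<^sup>2 * (1 + t\<^sup>2)))) integrable_on cbox 0 1"
      by (intro integrable_continuous continuous_intros) (auto simp: one_plus_square_neq_0)
  next
    show "continuous_on (UNIV \<times> cbox 0 1) (\<lambda>(x, t). - 2 * \<i> * of_real x * cis (- (x\<^sup>2 * (1 + t\<^sup>2))))"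
      by (auto intro!: continuous_intros simp: split_beta)
  qed auto
  moreover have "integral (cbox 0 1) (\<lambda>t. - 2 * \<i> * of_real x * cis (- (x\<^sup>2 * (1 + t\<^sup>2))))
     = - 2 * \<i> * cis (- x\<^sup>2) * fresnel x"
  proof (rule integral_unique)
    have "- 2 * \<i> * of_real x * cis (- (x\<^sup>2 * (1 + t\<^sup>2)))
       = (- 2 * \<i> * cis (- x\<^sup>2)) * (of_real x * cis (- (x * t)\<^sup>2))" for t
    proof -
      have "- (x\<^sup>2 * (1 + t\<^sup>2)) = - x\<^sup>2 + - (x * t)\<^sup>2" by (simp add: power_mult_distrib algebra_simps)
      then have "cis (- (x\<^sup>2 * (1 + t\<^sup>2))) = cis (- x\<^sup>2) * cis (- (x * t)\<^sup>2)" by (simp only: cis_mult)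
      then show ?thesis by simp
    qed
    then show "((\<lambda>t. - 2 * \<i> * of_real x * cis (- (x\<^sup>2 * (1 + t\<^sup>2)))) has_integral
        - 2 * \<i> * cis (- x\<^sup>2) * fresnel x) (cbox 0 1)"
      using has_integral_mult_right [OF fresnel_scaled [OF assms], of "- 2 * \<i> * cis (- x\<^sup>2)"]
      by (simp only: cbox_interval)
  qed
  ultimately show ?thesis unfolding fresnel_aux_def [abs_def] cbox_interval by (simp only:)
qed

text \<open>
The derivative of \<open>fresnel\<^sup>2\<close> is \<open>2 cis(- x\<^sup>2) fresnel x\<close>, which is \<open>\<i>\<close> times that of \<open>fresnel_aux\<close>.
The constant comes from \<open>x = 0\<close>.
\<close>

lemma fresnel_square:
  assumes "0 \<le> x"
  shows "(fresnel x)\<^sup>2 = \<i> * (fresnel_aux x - of_real (pi / 4))"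
proof -
  have D: "((\<lambda>x. fresnel x * fresnel x - \<i> * fresnel_aux x) has_vector_derivative 0) (at y within {0..x})"
    if "y \<in> {0..x}" for y
  proof -
    have y: "0 \<le> y" "y \<le> x" using that by auto
    from has_vector_derivative_diff [OF has_vector_derivative_mult [OF fresnel_has_vector_derivative [OF y] fresnel_has_vector_derivative [OF y]]
      has_vector_derivative_mult_right [OF has_vector_derivative_at_within [OF fresnel_aux_has_vector_derivative [OF y(1)]], of \<i>]]
    show ?thesis by (simp add: mult_ac)
  qed
  have "\<exists>c. \<forall>y\<in>{0..x}. fresnel y * fresnel y - \<i> * fresnel_aux y = c"
    by (rule has_vector_derivative_zero_constant [OF convex_real_interval(5) D]) auto
  then obtain c where c: "\<And>y. y \<in> {0..x} \<Longrightarrow> fresnel y * fresnel y - \<i> * fresnel_aux y = c"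
    by blast
  have "fresnel x * fresnel x - \<i> * fresnel_aux x = - \<i> * of_real (pi / 4)"
    using c [of x] c [of 0] assms by (simp add: fresnel_aux_0)
  then show ?thesis by (simp add: power2_eq_square algebra_simps)
qed

lemma norm_fresnel_aux_le: "norm (fresnel_aux x) \<le> 1"
proof -
  have "norm (integral {0..1} (\<lambda>t. of_real (1 / (1 + t\<^sup>2)) * cis (- (x\<^sup>2 * (1 + t\<^sup>2))))) \<le> 1 * (1 - 0)"
  proof (rule integral_bound)
    show "continuous_on {0..1} (\<lambda>t. complex_of_real (1 / (1 + t\<^sup>2)) * cis (- (x\<^sup>2 * (1 + t\<^sup>2))))"
      by (intro continuous_intros) (auto simp: one_plus_square_neq_0)
    show "norm (complex_of_real (1 / (1 + t\<^sup>2)) * cis (- (x\<^sup>2 * (1 + t\<^sup>2)))) \<le> 1" for t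
    proof -
      have p: "0 < 1 + t\<^sup>2" using one_plus_square_neq_0 [of t] zero_le_power2 [of t] by linarith
      then have "\<bar>1 / (1 + t\<^sup>2)\<bar> \<le> 1" by (simp add: pos_divide_le_eq)
      then show ?thesis by (simp only: norm_mult norm_of_real norm_cis mult_1_right)
    qed
  qed simp
  then show ?thesis by (simp add: fresnel_aux_def)
qed

text \<open>
Boundedness is read off the identity for the square, since the auxiliary integral is trivially
bounded.
\<close>

lemma norm_fresnel_le: "0 \<le> x \<Longrightarrow> norm (fresnel x) \<le> 2"
proof -
  assume x: "0 \<le> x"
  have "(norm (fresnel x))\<^sup>2 = norm (fresnel_aux x - of_real (pi / 4))"
    by (simp add: norm_power [symmetric] fresnel_square [OF x] norm_mult)
  also have "\<dots> \<le> norm (fresnel_aux x) + norm (complex_of_real (pi / 4))"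
    by (rule norm_triangle_ineq4)
  also have "\<dots> \<le> 1 + pi / 4"
    by (intro add_mono norm_fresnel_aux_le) simp
  also have "\<dots> \<le> 2\<^sup>2" using pi_less_4 by simp
  finally show ?thesis by (rule power2_le_imp_le) simp
qed

text \<open>
Up to the factor \<open>cis(- x\<^sup>2)\<close>, the auxiliary integral is that of \<open>cis(- (xt)\<^sup>2) / (1 + t\<^sup>2)\<close>. The first factor has
the bounded primitive \<open>fresnel(xt)/x\<close>, and integration by parts gains \<open>1/x\<close>.
\<close>

lemma fresnel_aux_decay:
  assumes "0 < x"
  shows "norm (fresnel_aux x) \<le> 5 / x"
proof -
  define H where "H t = fresnel (x * t)" for t
  define d where "d t = - 2 * t / (1 + t\<^sup>2)\<^sup>2" for t :: real
  have dH: "(H has_vector_derivative of_real x * cis (- (x * t)\<^sup>2)) (at t within {0..1})"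
    if t: "t \<in> {0..1}" for t
    unfolding H_def [abs_def] using fresnel_mult_has_vector_derivative [OF _ t] assms by simp
  have "((\<lambda>t. 1 / (1 + t\<^sup>2)) has_real_derivative d t) (at t)" for t
    unfolding d_def using one_plus_square_neq_0 [of t]
    by (auto intro!: derivative_eq_intros simp: power2_eq_square)
  from has_vector_derivative_of_real [OF has_field_derivative_at_within [OF this], where 'a = complex]
  have dphi: "((\<lambda>t. complex_of_real (1 / (1 + t\<^sup>2))) has_vector_derivative of_real (d t)) (at t within {0..1})" for t .
  have "((\<lambda>t. H t * of_real (d t) + of_real x * cis (- (x * t)\<^sup>2) * of_real (1 / (1 + t\<^sup>2))) has_integral
     H 1 * of_real (1 / (1 + 1\<^sup>2)) - H 0 * of_real (1 / (1 + 0\<^sup>2))) {0..1}"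
    by (rule fundamental_theorem_of_calculus) (auto intro!: has_vector_derivative_mult dH dphi simp del: of_real_divide)
  moreover have "H 1 * of_real (1 / (1 + 1\<^sup>2)) - H 0 * of_real (1 / (1 + 0\<^sup>2)) = fresnel x / 2"
    by (simp add: H_def)
  ultimately have sum: "((\<lambda>t. H t * of_real (d t) + of_real x * cis (- (x * t)\<^sup>2) * of_real (1 / (1 + t\<^sup>2))) has_integral
     fresnel x / 2) {0..1}" by (simp only:)
  have "continuous_on {0..1} H"
    unfolding continuous_on_eq_continuous_within using dH has_vector_derivative_continuous by blast
  moreover have "continuous_on {0..1} d"
    unfolding d_def by (intro continuous_intros) (auto simp: one_plus_square_neq_0)
  ultimately have cHd: "continuous_on {0..1} (\<lambda>t. H t * of_real (d t))"
    by (intro continuous_intros)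
  then have "((\<lambda>t. H t * of_real (d t)) has_integral integral {0..1} (\<lambda>t. H t * of_real (d t))) {0..1}"
    by (intro integrable_integral integrable_continuous_real)
  from has_integral_diff [OF sum this]
  have "((\<lambda>t. of_real x * cis (- (x * t)\<^sup>2) * of_real (1 / (1 + t\<^sup>2))) has_integral
     (fresnel x / 2 - integral {0..1} (\<lambda>t. H t * of_real (d t)))) {0..1}"
    by (simp only: add_diff_cancel_left')
  from has_integral_mult_right [OF this, of "cis (- x\<^sup>2)"]
  have "((\<lambda>t. of_real x * (of_real (1 / (1 + t\<^sup>2)) * cis (- (x\<^sup>2 * (1 + t\<^sup>2))))) has_integral
     cis (- x\<^sup>2) * (fresnel x / 2 - integral {0..1} (\<lambda>t. H t * of_real (d t)))) {0..1}"
    by (rule has_integral_eq_rhs [OF has_integral_eq, rotated])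
      (auto simp: cis_mult algebra_simps power_mult_distrib)
  then have "of_real x * fresnel_aux x = cis (- x\<^sup>2) * (fresnel x / 2 - integral {0..1} (\<lambda>t. H t * of_real (d t)))"
    unfolding fresnel_aux_def by (simp only: integral_mult_right [symmetric] integral_unique)
  then have "norm (of_real x * fresnel_aux x) = norm (fresnel x / 2 - integral {0..1} (\<lambda>t. H t * of_real (d t)))"
    by (simp add: norm_mult)
  also have "\<dots> \<le> norm (fresnel x / 2) + norm (integral {0..1} (\<lambda>t. H t * of_real (d t)))"
    by (rule norm_triangle_ineq4)
  also have "\<dots> \<le> 1 + 4 * (1 - 0)"
  proof (rule add_mono)
    show "norm (fresnel x / 2) \<le> 1" using norm_fresnel_le [of x] assms by (simp add: norm_divide)
    show "norm (integral {0..1} (\<lambda>t. H t * of_real (d t))) \<le> 4 * (1 - 0)"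
    proof (rule integral_bound [OF _ cHd])
      fix t :: real assume t: "t \<in> {0..1}"
      have "1 \<le> (1 + t\<^sup>2)\<^sup>2" by (intro one_le_power) simp
      then have "\<bar>d t\<bar> \<le> 2 / 1" unfolding d_def abs_divide using t
        by (intro frac_le) auto
      moreover have "norm (H t) \<le> 2" unfolding H_def using t assms by (intro norm_fresnel_le) auto
      ultimately have "norm (H t) * \<bar>d t\<bar> \<le> 2 * 2" by (intro mult_mono) auto
      then show "norm (H t * of_real (d t)) \<le> 4" by (simp add: norm_mult)
    qed simp
  qed
  finally show ?thesis using assms by (simp add: norm_mult pos_le_divide_eq mult.commute)
qed

text \<open>
At \<open>x = 0\<close> the value is \<open>\<pi>/4\<close>. For \<open>x > 0\<close> the integrand cannot keep its maximum, because the cosine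
does not equal \<open>1\<close> on all of \<open>[x\<^sup>2, 2x\<^sup>2]\<close>.
\<close>

lemma Re_fresnel_aux_less:
  assumes "0 < x"
  shows "Re (fresnel_aux x) < pi / 4"
proof -
  define h where "h t = (1 - cos (x\<^sup>2 * (1 + t\<^sup>2))) / (1 + t\<^sup>2)" for t
  have pos: "0 < 1 + t\<^sup>2" for t :: real using zero_le_power2 [of t] by linarith
  have cont: "continuous_on {0..1} h"
    unfolding h_def by (auto intro!: continuous_intros simp: one_plus_square_neq_0)
  have int: "(\<lambda>t. of_real (1 / (1 + t\<^sup>2)) * cis (- (y\<^sup>2 * (1 + t\<^sup>2)))) integrable_on {0..1}" for y
    by (intro integrable_continuous_real continuous_intros) (auto simp: one_plus_square_neq_0)
  have "((\<lambda>t. Re (of_real (1 / (1 + t\<^sup>2)) * cis (- (y\<^sup>2 * (1 + t\<^sup>2))))) has_integral Re (fresnel_aux y)) {0..1}" for y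
    using has_integral_linear [OF integrable_integral [OF int [of y]] bounded_linear_Re]
    by (simp add: o_def fresnel_aux_def)
  from has_integral_diff [OF this [of 0] this [of x]]
  have "(h has_integral pi / 4 - Re (fresnel_aux x)) {0..1}"
    by (simp add: h_def [abs_def] fresnel_aux_0 diff_divide_distrib)
  then have eq: "integral {0..1} h = pi / 4 - Re (fresnel_aux x)" by (rule integral_unique)
  have nn: "0 \<le> h t" for t unfolding h_def using pos [of t] by simp
  have "integral {0..1} h \<noteq> 0"
  proof
    assume "integral {0..1} h = 0"
    then have "\<forall>t\<in>{0..1}. h t = 0"
      using integral_eq_0_iff [of 0 1 h] cont nn by simp
    then have one: "cos (x\<^sup>2 * (1 + t\<^sup>2)) = 1" if "t \<in> {0..1}" for t
      using that one_plus_square_neq_0 [of t] by (auto simp: h_def)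
    show False
    proof (cases "x < 1")
      case True
      have "x\<^sup>2 < 1" using assms True by (simp add: power_less_one_iff)
      then have "cos (x\<^sup>2) < cos 0" using assms pi_gt3 by (intro cos_monotone_0_pi) auto
      then show False using one [of 0] by simp
    next
      case False
      have c: "cos (x\<^sup>2) = 1" using one [of 0] by simp
      then have s: "sin (x\<^sup>2) = 0" using sin_cos_squared_add [of "x\<^sup>2"] by simp
      \<comment> \<open>The point \<open>t = 1/x\<close> shifts the argument of the cosine by exactly \<open>1\<close>.\<close>
      have "x\<^sup>2 * (1 + (1 / x)\<^sup>2) = x\<^sup>2 + 1" using assms by (simp add: field_simps)
      then have "cos (x\<^sup>2 + 1) = 1" using one [of "1 / x"] assms False by simp
      then have "cos 1 = (1 :: real)" by (simp add: cos_add c s)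
      moreover have "cos 1 < cos (0 :: real)" using pi_gt3 by (intro cos_monotone_0_pi) auto
      ultimately show False by simp
    qed
  qed
  moreover have "0 \<le> integral {0..1} h" using nn by (intro integral_nonneg integrable_continuous_real cont) auto
  ultimately show ?thesis using eq by linarith
qed

text \<open>
This selects the branch of the square root. If the real part vanished at some \<open>x > 0\<close>, the square
would be real there, whereas its imaginary part is \<open>Re (fresnel_aux x) - \<pi>/4 < 0\<close>. Near \<open>0\<close> the real part
is positive, so it stays positive by continuity.
\<close>

lemma Re_fresnel_pos:
  assumes "0 < x"
  shows "0 < Re (fresnel x)"
proof (rule ccontr)
  assume neg: "\<not> 0 < Re (fresnel x)"
  define e where "e = min 1 x"
  have e: "0 < e" "e \<le> 1" "e \<le> x" using assms by (auto simp: e_def)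
  have "((\<lambda>w. Re (cis (- w\<^sup>2))) has_integral Re (fresnel e)) {0..e}"
    using has_integral_linear [OF integrable_integral bounded_linear_Re, of "\<lambda>w. cis (- w\<^sup>2)" "{0..e}"]
    by (simp add: o_def fresnel_def integrable_continuous_real continuous_intros)
  then have Re_int: "((\<lambda>w. cos (w\<^sup>2)) has_integral Re (fresnel e)) {0..e}" by simp
  have const_int: "((\<lambda>w. cos 1) has_integral e * cos 1) {0..e}"
    using has_integral_const_real [of "cos 1 :: real" 0 e] e by simp
  have "cos 1 \<le> cos (w\<^sup>2)" if "w \<in> {0..e}" for w :: real
    using that e pi_gt3 by (intro cos_monotone_0_pi_le) (auto simp: power_le_one)
  from has_integral_le [OF const_int Re_int this] have "e * cos 1 \<le> Re (fresnel e)" by blast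
  moreover have "0 < e * cos (1 :: real)" using e pi_gt3 by (intro mult_pos_pos cos_gt_zero_pi) auto
  ultimately have "0 < Re (fresnel e)" by linarith
  have "continuous_on {0..x} fresnel"
    unfolding continuous_on_eq_continuous_within
    by (auto intro!: has_vector_derivative_continuous [OF fresnel_has_vector_derivative])
  then have "continuous_on {e..x} (\<lambda>y. Re (fresnel y))"
    using e by (intro continuous_intros) (auto intro: continuous_on_subset)
  with \<open>0 < Re (fresnel e)\<close> obtain y where y: "e \<le> y" "y \<le> x" "Re (fresnel y) = 0"
    using IVT2' [of "\<lambda>y. Re (fresnel y)" x 0 e] neg e by auto
  then have "0 < y" using e by simp
  have "Im ((fresnel y)\<^sup>2) = Re (fresnel_aux y) - pi / 4"
    using \<open>0 < y\<close> by (simp add: fresnel_square)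
  moreover have "Im ((fresnel y)\<^sup>2) = 0" using y by (simp add: power2_eq_square)
  ultimately show False using Re_fresnel_aux_less [OF \<open>0 < y\<close>] by simp
qed

lemma fresnel_limit: "(fresnel \<longlongrightarrow> of_real (sqrt pi / 2) * cis (- (pi / 4))) at_top"
proof -
  have "(fresnel_aux \<longlongrightarrow> 0) at_top"
  proof (rule Lim_null_comparison [OF _ const_over_at_top [of 5]])
    show "\<forall>\<^sub>F x in at_top. norm (fresnel_aux x) \<le> 5 / x"
      using eventually_gt_at_top [of 0] by (rule eventually_mono) (rule fresnel_aux_decay)
  qed
  then have "((\<lambda>x. \<i> * (fresnel_aux x - of_real (pi / 4))) \<longlongrightarrow> \<i> * (0 - of_real (pi / 4))) at_top"
    by (intro tendsto_intros)
  then have "((\<lambda>x. csqrt (\<i> * (fresnel_aux x - of_real (pi / 4)))) \<longlongrightarrow> csqrt (\<i> * (0 - of_real (pi / 4)))) at_top"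
    by (intro isCont_tendsto_compose [OF continuous_at_csqrt]) (auto simp: complex_nonpos_Reals_iff)
  moreover have "\<forall>\<^sub>F x in at_top. csqrt (\<i> * (fresnel_aux x - of_real (pi / 4))) = fresnel x"
    using eventually_gt_at_top [of 0]
  proof (rule eventually_mono)
    fix x :: real assume x: "0 < x"
    show "csqrt (\<i> * (fresnel_aux x - of_real (pi / 4))) = fresnel x"
      by (rule csqrt_unique) (use x fresnel_square [of x] Re_fresnel_pos [of x] in auto)
  qed
  ultimately have "(fresnel \<longlongrightarrow> csqrt (\<i> * (0 - of_real (pi / 4)))) at_top"
    by (rule Lim_transform_eventually)
  moreover have "csqrt (\<i> * (0 - of_real (pi / 4))) = of_real (sqrt pi / 2) * cis (- (pi / 4))"
  proof (rule csqrt_unique)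
    have sq: "(sqrt pi / 2)\<^sup>2 = pi / 4" by (simp add: power_divide)
    have "(of_real (sqrt pi / 2) * cis (- (pi / 4)))\<^sup>2 = of_real ((sqrt pi / 2)\<^sup>2) * (cis (- (pi / 4)) * cis (- (pi / 4)))"
      by (simp only: power2_eq_square of_real_mult mult_ac)
    also have "cis (- (pi / 4)) * cis (- (pi / 4)) = - \<i>"
      unfolding cis_mult by (simp add: complex_eq_iff)
    also have "of_real ((sqrt pi / 2)\<^sup>2) * - \<i> = \<i> * (0 - of_real (pi / 4))"
      unfolding sq by simp
    finally show "(of_real (sqrt pi / 2) * cis (- (pi / 4)))\<^sup>2 = \<i> * (0 - of_real (pi / 4))" .
    have "0 < sqrt pi / 2 * cos (pi / 4)" by (simp add: cos_45)
    then show "0 < Re (of_real (sqrt pi / 2) * cis (- (pi / 4))) \<or>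
      Re (of_real (sqrt pi / 2) * cis (- (pi / 4))) = 0 \<and> 0 \<le> Im (of_real (sqrt pi / 2) * cis (- (pi / 4)))" by simp
  qed
  ultimately show ?thesis by (simp only:)
qed

section \<open>Stationary phase for the Bessel functions\<close>

text \<open>
The phase \<open>z cos \<phi>\<close> has derivative \<open>- z sin \<phi>\<close>, so a factor \<open>sin \<phi>\<close> in the amplitude cancels the
stationary point \<open>\<phi> = 0\<close> and integration by parts gains \<open>1/z\<close>.
\<close>

lemma oscillatory_integral_bound:
  fixes k k' :: "real \<Rightarrow> real"
  assumes k: "\<And>\<phi>. \<phi> \<in> {0..pi / 2} \<Longrightarrow> (k has_real_derivative k' \<phi>) (at \<phi> within {0..pi / 2})"
    and k': "continuous_on {0..pi / 2} k'"
  obtains C where "\<And>z. 0 < z \<Longrightarrow>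
    norm (integral {0..pi / 2} (\<lambda>\<phi>. of_real (sin \<phi> * k \<phi>) * cis (z * cos \<phi>))) \<le> C / z"
proof -
  have "bounded (k' ` {0..pi / 2})"
    by (intro compact_imp_bounded compact_continuous_image k') simp
  then obtain M where "\<forall>y\<in>k' ` {0..pi / 2}. norm y \<le> M"
    unfolding bounded_iff by blast
  then have M: "\<bar>k' \<phi>\<bar> \<le> M" if "\<phi> \<in> {0..pi / 2}" for \<phi>
    using that by simp
  have ck: "continuous_on {0..pi / 2} k"
    using k by (rule DERIV_continuous_on)
  show ?thesis
  proof
    fix z :: real assume z: "0 < z"
    define f where "f \<phi> = of_real (sin \<phi> * k \<phi>) * cis (z * cos \<phi>)" for \<phi>
    define g where "g \<phi> = of_real (k' \<phi>) * cis (z * cos \<phi>)" for \<phi>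
    have "((\<lambda>\<phi>. of_real (k \<phi>) * (of_real (- z * sin \<phi>) * (\<i> * cis (z * cos \<phi>))) + of_real (k' \<phi>) * cis (z * cos \<phi>))
        has_integral of_real (k (pi / 2)) * cis (z * cos (pi / 2)) - of_real (k 0) * cis (z * cos 0)) {0..pi / 2}"
    proof (rule fundamental_theorem_of_calculus)
      fix \<phi> :: real assume p: "\<phi> \<in> {0..pi / 2}"
      show "((\<lambda>\<phi>. of_real (k \<phi>) * cis (z * cos \<phi>)) has_vector_derivative
        of_real (k \<phi>) * (of_real (- z * sin \<phi>) * (\<i> * cis (z * cos \<phi>))) + of_real (k' \<phi>) * cis (z * cos \<phi>))
        (at \<phi> within {0..pi / 2})"
        by (intro has_vector_derivative_mult has_vector_derivative_of_real k p cis_has_vector_derivative)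
          (auto intro!: derivative_eq_intros)
    qed simp
    then have "((\<lambda>\<phi>. - \<i> * of_real z * f \<phi> + g \<phi>) has_integral of_real (k (pi / 2)) - of_real (k 0) * cis z) {0..pi / 2}"
      by (simp add: f_def g_def algebra_simps)
    moreover have cg: "continuous_on {0..pi / 2} g"
      unfolding g_def by (intro continuous_intros k')
    then have "(g has_integral integral {0..pi / 2} g) {0..pi / 2}"
      by (intro integrable_integral integrable_continuous_real)
    ultimately have "((\<lambda>\<phi>. - \<i> * of_real z * f \<phi> + g \<phi> - g \<phi>) has_integral of_real (k (pi / 2)) - of_real (k 0) * cis z - integral {0..pi / 2} g) {0..pi / 2}"
      by (rule has_integral_diff)
    then have "integral {0..pi / 2} (\<lambda>\<phi>. - \<i> * of_real z * f \<phi>) = of_real (k (pi / 2)) - of_real (k 0) * cis z - integral {0..pi / 2} g"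
      by (simp only: add_diff_cancel_right' integral_unique)
    then have eq: "- \<i> * of_real z * integral {0..pi / 2} f = of_real (k (pi / 2)) - of_real (k 0) * cis z - integral {0..pi / 2} g"
      by (simp only: integral_mult_right)
    have "z * norm (integral {0..pi / 2} f) = norm (- \<i> * of_real z * integral {0..pi / 2} f)"
      using z by (simp add: norm_mult)
    also have "\<dots> \<le> norm (of_real (k (pi / 2)) - of_real (k 0) * cis z) + norm (integral {0..pi / 2} g)"
      unfolding eq by (rule norm_triangle_ineq4)
    also have "norm (of_real (k (pi / 2)) - of_real (k 0) * cis z) \<le> \<bar>k (pi / 2)\<bar> + \<bar>k 0\<bar>"
      by (rule order_trans [OF norm_triangle_ineq4]) (simp add: norm_mult)
    also have "norm (integral {0..pi / 2} g) \<le> M * (pi / 2 - 0)"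
      by (rule integral_bound [OF _ cg]) (auto simp: g_def norm_mult M)
    finally have "z * norm (integral {0..pi / 2} f) \<le> \<bar>k (pi / 2)\<bar> + \<bar>k 0\<bar> + M * (pi / 2)" by simp
    then show "norm (integral {0..pi / 2} (\<lambda>\<phi>. of_real (sin \<phi> * k \<phi>) * cis (z * cos \<phi>)))
       \<le> (\<bar>k (pi / 2)\<bar> + \<bar>k 0\<bar> + M * (pi / 2)) / z"
      using z by (simp add: f_def [abs_def] pos_le_divide_eq mult.commute)
  qed
qed

text \<open>
Since \<open>cos \<phi> = 1 - 2 sin\<^sup>2(\<phi>/2)\<close>, the substitution \<open>v = \<surd>(2z) sin(\<phi>/2)\<close> makes the phase exactly
\<open>z - v\<^sup>2\<close>. The amplitude \<open>cos(\<phi>/2)\<close> supplies \<open>dv\<close>.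
\<close>

lemma cos_half_integral:
  assumes "0 < z"
  shows "((\<lambda>\<phi>. of_real (cos (\<phi> / 2)) * cis (z * cos \<phi>)) has_integral
     of_real (sqrt 2 / sqrt z) * cis z * fresnel (sqrt z)) {0..pi / 2}"
proof -
  define v where "v \<phi> = sqrt z * (sqrt 2 * sin (\<phi> / 2))" for \<phi>
  have v2: "- (v \<phi>)\<^sup>2 = z * cos \<phi> - z" for \<phi>
  proof -
    have "cos \<phi> = cos (2 * (\<phi> / 2))" by simp
    also have "\<dots> = 1 - 2 * (sin (\<phi> / 2))\<^sup>2" by (rule cos_double_sin)
    finally have c: "cos \<phi> = 1 - 2 * (sin (\<phi> / 2))\<^sup>2" .
    show ?thesis unfolding v_def c using assms by (simp add: power_mult_distrib right_diff_distrib)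
  qed
  have v_bot: "v 0 = 0" by (simp add: v_def)
  have v_top: "v (pi / 2) = sqrt z" by (simp add: v_def sin_45)
  have "((\<lambda>\<phi>. (sqrt z * (sqrt 2 * (cos (\<phi> / 2) / 2))) *\<^sub>R cis (- (v \<phi>)\<^sup>2)) has_integral
      (fresnel \<circ> v) (pi / 2) - (fresnel \<circ> v) 0) {0..pi / 2}"
  proof (rule fundamental_theorem_of_calculus)
    fix \<phi> :: real assume p: "\<phi> \<in> {0..pi / 2}"
    have rng: "0 \<le> v u \<and> v u \<le> sqrt z" if "u \<in> {0..pi / 2}" for u
    proof -
      have "0 \<le> sin (u / 2)" using that by (intro sin_ge_zero) auto
      moreover have "sin (u / 2) \<le> sin (pi / 4)"
        using that pi_gt3 by (intro sin_monotone_2pi_le) auto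
      then have "sqrt 2 * sin (u / 2) \<le> sqrt 2 * sin (pi / 4)" by (intro mult_left_mono) auto
      then have "sqrt 2 * sin (u / 2) \<le> 1" by (simp add: sin_45)
      ultimately show ?thesis using assms by (auto simp: v_def mult_left_le)
    qed
    have "(v has_vector_derivative sqrt z * (sqrt 2 * (cos (\<phi> / 2) / 2))) (at \<phi> within {0..pi / 2})"
      unfolding v_def [abs_def] has_real_derivative_iff_has_vector_derivative [symmetric]
      by (auto intro!: derivative_eq_intros)
    moreover have "v ` {0..pi / 2} \<subseteq> {0..sqrt z}"
    proof
      fix y assume "y \<in> v ` {0..pi / 2}"
      then obtain u where u: "u \<in> {0..pi / 2}" "y = v u" by blast
      show "y \<in> {0..sqrt z}" unfolding u(2) using rng [OF u(1)] by simp
    qed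
    then have "(fresnel has_vector_derivative cis (- (v \<phi>)\<^sup>2)) (at (v \<phi>) within v ` {0..pi / 2})"
      using rng [OF p] has_vector_derivative_within_subset [OF fresnel_has_vector_derivative [of "v \<phi>" "sqrt z"]]
      by blast
    ultimately show "(fresnel \<circ> v has_vector_derivative (sqrt z * (sqrt 2 * (cos (\<phi> / 2) / 2))) *\<^sub>R cis (- (v \<phi>)\<^sup>2))
        (at \<phi> within {0..pi / 2})"
      by (rule vector_diff_chain_within)
  qed simp
  moreover have ends: "(fresnel \<circ> v) (pi / 2) - (fresnel \<circ> v) 0 = fresnel (sqrt z)"
    by (simp add: v_top v_bot)
  ultimately have "((\<lambda>\<phi>. (sqrt z * (sqrt 2 * (cos (\<phi> / 2) / 2))) *\<^sub>R cis (- (v \<phi>)\<^sup>2)) has_integral fresnel (sqrt z)) {0..pi / 2}"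
    by (simp only:)
  from has_integral_mult_right [OF this, of "of_real (sqrt 2 / sqrt z) * cis z"]
  show ?thesis
  proof (rule has_integral_eq [rotated])
    fix \<phi> :: real
    have "cis z * cis (- (v \<phi>)\<^sup>2) = cis (z * cos \<phi>)" unfolding v2 cis_mult by simp
    moreover have "(sqrt 2 / sqrt z) * (sqrt z * (sqrt 2 * (cos (\<phi> / 2) / 2))) = cos (\<phi> / 2)"
      using assms by simp
    then have "of_real (sqrt 2 / sqrt z) * of_real (sqrt z * (sqrt 2 * (cos (\<phi> / 2) / 2))) = complex_of_real (cos (\<phi> / 2))"
      by (simp only: of_real_mult [symmetric])
    moreover have "of_real (sqrt 2 / sqrt z) * cis z * ((sqrt z * (sqrt 2 * (cos (\<phi> / 2) / 2))) *\<^sub>R cis (- (v \<phi>)\<^sup>2))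
       = (of_real (sqrt 2 / sqrt z) * of_real (sqrt z * (sqrt 2 * (cos (\<phi> / 2) / 2)))) * (cis z * cis (- (v \<phi>)\<^sup>2))"
      by (simp only: scaleR_conv_of_real mult_ac)
    ultimately show "of_real (sqrt 2 / sqrt z) * cis z * ((sqrt z * (sqrt 2 * (cos (\<phi> / 2) / 2))) *\<^sub>R cis (- (v \<phi>)\<^sup>2))
      = of_real (cos (\<phi> / 2)) * cis (z * cos \<phi>)" by (simp only:)
  qed
qed

text \<open>
The leading term of stationary phase at \<open>\<phi> = 0\<close> for an amplitude \<open>f\<close> with \<open>f(0) = 1\<close>. The
comparison of \<open>f\<close> with \<open>cos(\<phi>/2)\<close> leaves a multiple of \<open>sin \<phi>\<close>.
\<close>

lemma sqrt_oscillatory_limit: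
  fixes f k k' :: "real \<Rightarrow> real"
  assumes f: "\<And>\<phi>. \<phi> \<in> {0..pi / 2} \<Longrightarrow> f \<phi> = cos (\<phi> / 2) + sin \<phi> * k \<phi>"
    and k: "\<And>\<phi>. \<phi> \<in> {0..pi / 2} \<Longrightarrow> (k has_real_derivative k' \<phi>) (at \<phi> within {0..pi / 2})"
    and k': "continuous_on {0..pi / 2} k'"
  shows "((\<lambda>z. of_real (sqrt z) * integral {0..pi / 2} (\<lambda>\<phi>. of_real (f \<phi>) * cis (z * cos \<phi>))
      - of_real (sqrt (pi / 2)) * cis (z - pi / 4)) \<longlongrightarrow> 0) at_top"
proof -
  obtain C where C: "\<And>z. 0 < z \<Longrightarrow>
    norm (integral {0..pi / 2} (\<lambda>\<phi>. of_real (sin \<phi> * k \<phi>) * cis (z * cos \<phi>))) \<le> C / z"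
    using oscillatory_integral_bound [OF k k'] by blast
  define L where "L = of_real (sqrt pi / 2) * cis (- (pi / 4))"
  define I where "I z = integral {0..pi / 2} (\<lambda>\<phi>. of_real (sin \<phi> * k \<phi>) * cis (z * cos \<phi>))" for z
  have ck: "continuous_on {0..pi / 2} k"
    using k by (rule DERIV_continuous_on)
  have split: "integral {0..pi / 2} (\<lambda>\<phi>. of_real (f \<phi>) * cis (z * cos \<phi>))
     = of_real (sqrt 2 / sqrt z) * cis z * fresnel (sqrt z) + I z" if z: "0 < z" for z
  proof -
    have "((\<lambda>\<phi>. of_real (sin \<phi> * k \<phi>) * cis (z * cos \<phi>)) has_integral I z) {0..pi / 2}"
      unfolding I_def by (intro integrable_integral integrable_continuous_real continuous_intros ck)
    from has_integral_add [OF cos_half_integral [OF z] this]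
    have "((\<lambda>\<phi>. of_real (f \<phi>) * cis (z * cos \<phi>)) has_integral
       of_real (sqrt 2 / sqrt z) * cis z * fresnel (sqrt z) + I z) {0..pi / 2}"
      by (rule has_integral_eq [rotated]) (simp add: f distrib_right)
    then show ?thesis by (rule integral_unique)
  qed
  have bnd: "norm (of_real (sqrt z) * integral {0..pi / 2} (\<lambda>\<phi>. of_real (f \<phi>) * cis (z * cos \<phi>))
      - of_real (sqrt (pi / 2)) * cis (z - pi / 4)) \<le> sqrt 2 * norm (fresnel (sqrt z) - L) + C / sqrt z"
    if z: "0 < z" for z
  proof -
    have "sqrt 2 * (sqrt pi / 2) = sqrt (pi / 2)"
      by (simp add: real_sqrt_divide real_div_sqrt field_simps)
    then have "of_real (sqrt 2) * of_real (sqrt pi / 2) = complex_of_real (sqrt (pi / 2))"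
      by (simp only: of_real_mult [symmetric])
    moreover have "cis z * cis (- (pi / 4)) = cis (z - pi / 4)" by (simp add: cis_mult)
    moreover have "of_real (sqrt 2) * cis z * L
      = (of_real (sqrt 2) * of_real (sqrt pi / 2)) * (cis z * cis (- (pi / 4)))"
      unfolding L_def by (simp only: mult_ac)
    ultimately have main: "of_real (sqrt (pi / 2)) * cis (z - pi / 4) = of_real (sqrt 2) * cis z * L"
      by (simp only:)
    have "sqrt z * (sqrt 2 / sqrt z) = sqrt 2" using z by simp
    then have s: "of_real (sqrt z) * of_real (sqrt 2 / sqrt z) = complex_of_real (sqrt 2)"
      by (simp only: of_real_mult [symmetric])
    have "of_real (sqrt z) * (of_real (sqrt 2 / sqrt z) * cis z * fresnel (sqrt z) + I z)
      - of_real (sqrt 2) * cis z * L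
      = (of_real (sqrt z) * of_real (sqrt 2 / sqrt z)) * cis z * fresnel (sqrt z) - of_real (sqrt 2) * cis z * L + of_real (sqrt z) * I z"
      by (simp only: algebra_simps)
    also have "\<dots> = of_real (sqrt 2) * cis z * (fresnel (sqrt z) - L) + of_real (sqrt z) * I z"
      unfolding s by (simp only: algebra_simps)
    finally have "norm (of_real (sqrt z) * (of_real (sqrt 2 / sqrt z) * cis z * fresnel (sqrt z) + I z)
      - of_real (sqrt 2) * cis z * L) \<le> norm (of_real (sqrt 2) * cis z * (fresnel (sqrt z) - L)) + norm (of_real (sqrt z) * I z)"
      by (simp only: norm_triangle_ineq)
    also have "norm (of_real (sqrt 2) * cis z * (fresnel (sqrt z) - L)) = sqrt 2 * norm (fresnel (sqrt z) - L)"
      by (simp add: norm_mult)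
    also have "norm (of_real (sqrt z) * I z) \<le> C / sqrt z"
    proof -
      have "norm (of_real (sqrt z) * I z) = sqrt z * norm (I z)" using z by (simp add: norm_mult)
      also have "\<dots> \<le> sqrt z * (C / z)" using C [OF z] z unfolding I_def by (intro mult_left_mono) auto
      also have "\<dots> = C / sqrt z" using z by (simp add: field_simps)
      finally show ?thesis .
    qed
    finally show ?thesis unfolding split [OF z] main by simp
  qed
  have sqrt_lim: "filterlim sqrt at_top at_top" by (rule sqrt_at_top)
  have "((\<lambda>z. fresnel (sqrt z)) \<longlongrightarrow> L) at_top"
    unfolding L_def by (rule filterlim_compose [OF fresnel_limit sqrt_lim])
  then have "((\<lambda>z. sqrt 2 * norm (fresnel (sqrt z) - L) + C / sqrt z) \<longlongrightarrow> sqrt 2 * norm (L - L) + 0) at_top"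
    by (intro tendsto_intros filterlim_compose [OF const_over_at_top sqrt_lim])
  then have lim0: "((\<lambda>z. sqrt 2 * norm (fresnel (sqrt z) - L) + C / sqrt z) \<longlongrightarrow> 0) at_top" by simp
  show ?thesis
    by (rule Lim_null_comparison [OF _ lim0]) (rule eventually_mono [OF eventually_gt_at_top [of 0]], rule bnd)
qed

definition Bessel_J0 :: "real \<Rightarrow> real" where
  "Bessel_J0 z = avg (\<lambda>\<phi>. cos (z * cos \<phi>))"

definition Bessel_J1 :: "real \<Rightarrow> real" where
  "Bessel_J1 z = avg (\<lambda>\<phi>. cos \<phi> * sin (z * cos \<phi>))"

text \<open>
The amplitude is \<open>1\<close> for \<open>J\<^sub>0\<close> and \<open>cos \<phi>\<close> for \<open>J\<^sub>1\<close>. In both cases the difference from \<open>cos(\<phi>/2)\<close>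
is divided by \<open>sin \<phi>\<close> by means of half-angle formulas:
\<open>1 - cos(\<phi>/2) = sin \<phi> tan(\<phi>/4) / (2 cos(\<phi>/2))\<close> and \<open>1 - cos \<phi> = sin \<phi> tan(\<phi>/2)\<close>.
\<close>

lemma Bessel_limits:
  "((\<lambda>z. sqrt z * Bessel_J0 z - sqrt (2 / pi) * cos (z - pi / 4)) \<longlongrightarrow> 0) at_top"
  "((\<lambda>z. sqrt z * Bessel_J1 z - sqrt (2 / pi) * sin (z - pi / 4)) \<longlongrightarrow> 0) at_top"
proof -
  have \<alpha>: "2 / pi * sqrt (pi / 2) = sqrt (2 / pi)"
    by (simp add: real_sqrt_divide real_div_sqrt field_simps)
  have half: "cos (\<phi> / 2) > 0" "cos (\<phi> / 4) > 0" if "\<phi> \<in> {0..pi / 2}" for \<phi>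
    using that pi_gt3 by (auto intro!: cos_gt_zero_pi)
  have c_half: "cos \<phi> = 2 * (cos (\<phi> / 2))\<^sup>2 - 1" "sin \<phi> = 2 * sin (\<phi> / 2) * cos (\<phi> / 2)" for \<phi> :: real
    using cos_double_cos [of "\<phi> / 2"] sin_double [of "\<phi> / 2"] by simp_all
  show "((\<lambda>z. sqrt z * Bessel_J0 z - sqrt (2 / pi) * cos (z - pi / 4)) \<longlongrightarrow> 0) at_top"
  proof -
    define k where "k \<phi> = tan (\<phi> / 4) / (2 * cos (\<phi> / 2))" for \<phi> :: real
    define k' where "k' \<phi> = (inverse ((cos (\<phi> / 4))\<^sup>2) / 4 * (2 * cos (\<phi> / 2)) + tan (\<phi> / 4) * sin (\<phi> / 2)) / (2 * cos (\<phi> / 2))\<^sup>2" for \<phi> :: real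
    have "((\<lambda>z. of_real (sqrt z) * integral {0..pi / 2} (\<lambda>\<phi>. of_real 1 * cis (z * cos \<phi>))
      - of_real (sqrt (pi / 2)) * cis (z - pi / 4)) \<longlongrightarrow> 0) at_top"
    proof (rule sqrt_oscillatory_limit [where k = k and k' = k'])
      fix \<phi> :: real assume p: "\<phi> \<in> {0..pi / 2}"
      note h = half [OF p]
      have "sin \<phi> * k \<phi> = sin (\<phi> / 2) * tan (\<phi> / 4)"
        using h unfolding k_def c_half(2) [of \<phi>] by simp
      also have "\<dots> = 2 * (sin (\<phi> / 4))\<^sup>2"
        using h c_half(2) [of "\<phi> / 2"] by (simp add: tan_def power2_eq_square)
      also have "\<dots> = 1 - cos (\<phi> / 2)"
        using cos_double_sin [of "\<phi> / 4"] by simp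
      finally show "1 = cos (\<phi> / 2) + sin \<phi> * k \<phi>" by simp
      show "(k has_real_derivative k' \<phi>) (at \<phi> within {0..pi / 2})"
        unfolding k_def [abs_def] k'_def using h
        by (auto intro!: derivative_eq_intros simp: power2_eq_square)
    next
      show "continuous_on {0..pi / 2} k'"
        unfolding k'_def using half by (intro continuous_intros) (fastforce simp: less_imp_neq)+
    qed
    from tendsto_Re [OF this]
    have lim: "((\<lambda>z. sqrt z * Re (integral {0..pi / 2} (\<lambda>\<phi>. cis (z * cos \<phi>))) - sqrt (pi / 2) * cos (z - pi / 4)) \<longlongrightarrow> 0) at_top"
      by simp
    have int_eq: "Re (integral {0..pi / 2} (\<lambda>\<phi>. cis (z * cos \<phi>))) = integral {0..pi / 2} (\<lambda>\<phi>. cos (z * cos \<phi>))" for z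
      using integral_linear [OF _ bounded_linear_Re, of "\<lambda>\<phi>. cis (z * cos \<phi>)" "{0..pi / 2}"]
      by (simp add: o_def integrable_continuous_real continuous_intros)
    have "2 / pi * (sqrt z * Re (integral {0..pi / 2} (\<lambda>\<phi>. cis (z * cos \<phi>))) - sqrt (pi / 2) * cos (z - pi / 4))
      = sqrt z * Bessel_J0 z - sqrt (2 / pi) * cos (z - pi / 4)" for z
      unfolding Bessel_J0_def avg_def int_eq \<alpha> [symmetric] by (simp only: right_diff_distrib mult_ac)
    with tendsto_mult_left [OF lim, of "2 / pi"] show ?thesis by (simp only: mult_zero_right)
  qed
  show "((\<lambda>z. sqrt z * Bessel_J1 z - sqrt (2 / pi) * sin (z - pi / 4)) \<longlongrightarrow> 0) at_top"
  proof -
    define k where "k \<phi> = tan (\<phi> / 4) / (2 * cos (\<phi> / 2)) - tan (\<phi> / 2)" for \<phi> :: real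
    define k' where "k' \<phi> = (inverse ((cos (\<phi> / 4))\<^sup>2) / 4 * (2 * cos (\<phi> / 2)) + tan (\<phi> / 4) * sin (\<phi> / 2)) / (2 * cos (\<phi> / 2))\<^sup>2
       - inverse ((cos (\<phi> / 2))\<^sup>2) / 2" for \<phi> :: real
    have "((\<lambda>z. of_real (sqrt z) * integral {0..pi / 2} (\<lambda>\<phi>. of_real (cos \<phi>) * cis (z * cos \<phi>))
      - of_real (sqrt (pi / 2)) * cis (z - pi / 4)) \<longlongrightarrow> 0) at_top"
    proof (rule sqrt_oscillatory_limit [where k = k and k' = k'])
      fix \<phi> :: real assume p: "\<phi> \<in> {0..pi / 2}"
      note h = half [OF p]
      have "sin \<phi> * k \<phi> = sin (\<phi> / 2) * tan (\<phi> / 4) - 2 * (sin (\<phi> / 2))\<^sup>2"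
        using h unfolding k_def c_half(2) [of \<phi>] by (simp add: tan_def power2_eq_square right_diff_distrib)
      moreover have "sin (\<phi> / 2) * tan (\<phi> / 4) = 2 * (sin (\<phi> / 4))\<^sup>2"
        using h c_half(2) [of "\<phi> / 2"] by (simp add: tan_def power2_eq_square)
      moreover have "2 * (sin (\<phi> / 4))\<^sup>2 = 1 - cos (\<phi> / 2)"
        using cos_double_sin [of "\<phi> / 4"] by simp
      moreover have "2 * (sin (\<phi> / 2))\<^sup>2 = 1 - cos \<phi>"
        using cos_double_sin [of "\<phi> / 2"] by simp
      ultimately show "cos \<phi> = cos (\<phi> / 2) + sin \<phi> * k \<phi>" by simp
      show "(k has_real_derivative k' \<phi>) (at \<phi> within {0..pi / 2})"
        unfolding k_def [abs_def] k'_def using h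
        by (auto intro!: derivative_eq_intros simp: power2_eq_square)
    next
      show "continuous_on {0..pi / 2} k'"
        unfolding k'_def using half by (intro continuous_intros) (fastforce simp: less_imp_neq)+
    qed
    from tendsto_Im [OF this]
    have lim: "((\<lambda>z. sqrt z * Im (integral {0..pi / 2} (\<lambda>\<phi>. of_real (cos \<phi>) * cis (z * cos \<phi>))) - sqrt (pi / 2) * sin (z - pi / 4)) \<longlongrightarrow> 0) at_top"
      by simp
    have int_eq: "Im (integral {0..pi / 2} (\<lambda>\<phi>. of_real (cos \<phi>) * cis (z * cos \<phi>))) = integral {0..pi / 2} (\<lambda>\<phi>. cos \<phi> * sin (z * cos \<phi>))" for z
      using integral_linear [OF _ bounded_linear_Im, of "\<lambda>\<phi>. of_real (cos \<phi>) * cis (z * cos \<phi>)" "{0..pi / 2}"]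
      by (simp add: o_def integrable_continuous_real continuous_intros)
    have "2 / pi * (sqrt z * Im (integral {0..pi / 2} (\<lambda>\<phi>. of_real (cos \<phi>) * cis (z * cos \<phi>))) - sqrt (pi / 2) * sin (z - pi / 4))
      = sqrt z * Bessel_J1 z - sqrt (2 / pi) * sin (z - pi / 4)" for z
      unfolding Bessel_J1_def avg_def int_eq \<alpha> [symmetric] by (simp only: right_diff_distrib mult_ac)
    with tendsto_mult_left [OF lim, of "2 / pi"] show ?thesis by (simp only: mult_zero_right)
  qed
qed

section \<open>Second order asymptotics of the Bessel functions\<close>

text \<open>
Integration by parts with the primitive \<open>- sin \<phi> sin(z cos \<phi>)\<close>. This identity serves twice: it is
Bessel's equation in disguise, and it evaluates the quadratic term of the endpoint expansion.
\<close>

lemma avg_sin_square: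
  assumes "z \<noteq> 0"
  shows "avg (\<lambda>\<phi>. (sin \<phi>)\<^sup>2 * cos (z * cos \<phi>)) = Bessel_J1 z / z"
proof -
  have "((\<lambda>\<phi>. z * ((sin \<phi>)\<^sup>2 * cos (z * cos \<phi>)) - cos \<phi> * sin (z * cos \<phi>)) has_integral
    - sin (pi / 2) * sin (z * cos (pi / 2)) - (- sin 0 * sin (z * cos 0))) {0..pi / 2}"
  proof (rule fundamental_theorem_of_calculus)
    fix \<phi> :: real
    show "((\<lambda>\<phi>. - sin \<phi> * sin (z * cos \<phi>)) has_vector_derivative
       z * ((sin \<phi>)\<^sup>2 * cos (z * cos \<phi>)) - cos \<phi> * sin (z * cos \<phi>)) (at \<phi> within {0..pi / 2})"
      unfolding has_real_derivative_iff_has_vector_derivative [symmetric]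
      by (auto intro!: derivative_eq_intros simp: power2_eq_square)
  qed simp
  then have "((\<lambda>\<phi>. z * ((sin \<phi>)\<^sup>2 * cos (z * cos \<phi>)) - cos \<phi> * sin (z * cos \<phi>)) has_integral 0) {0..pi / 2}"
    by simp
  moreover have "((\<lambda>\<phi>. z * ((sin \<phi>)\<^sup>2 * cos (z * cos \<phi>)) - cos \<phi> * sin (z * cos \<phi>)) has_integral
      z * integral {0..pi / 2} (\<lambda>\<phi>. (sin \<phi>)\<^sup>2 * cos (z * cos \<phi>)) - integral {0..pi / 2} (\<lambda>\<phi>. cos \<phi> * sin (z * cos \<phi>))) {0..pi / 2}"
    by (intro has_integral_diff has_integral_mult_right integrable_integral integrable_continuous_real continuous_intros)
  ultimately have "z * integral {0..pi / 2} (\<lambda>\<phi>. (sin \<phi>)\<^sup>2 * cos (z * cos \<phi>)) - integral {0..pi / 2} (\<lambda>\<phi>. cos \<phi> * sin (z * cos \<phi>)) = 0"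
    using has_integral_unique by blast
  then show ?thesis using assms by (simp add: Bessel_J1_def avg_def field_simps)
qed

lemma Bessel_J0_deriv: "(Bessel_J0 has_real_derivative - Bessel_J1 z) (at z)"
proof -
  have "((\<lambda>z. avg (\<lambda>\<phi>. cos (z * cos \<phi>))) has_real_derivative avg (\<lambda>\<phi>. - (cos \<phi> * sin (z * cos \<phi>)))) (at z)"
    by (rule has_real_derivative_avg)
      (auto intro!: derivative_eq_intros continuous_intros simp: split_beta)
  then show ?thesis by (simp add: Bessel_J0_def [abs_def] Bessel_J1_def avg_def)
qed

lemma Bessel_J1_deriv:
  assumes "z \<noteq> 0"
  shows "(Bessel_J1 has_real_derivative Bessel_J0 z - Bessel_J1 z / z) (at z)"
proof -
  have "((\<lambda>z. avg (\<lambda>\<phi>. cos \<phi> * sin (z * cos \<phi>))) has_real_derivative avg (\<lambda>\<phi>. (cos \<phi>)\<^sup>2 * cos (z * cos \<phi>))) (at z)"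
    by (rule has_real_derivative_avg)
      (auto intro!: derivative_eq_intros continuous_intros simp: split_beta power2_eq_square)
  moreover have "avg (\<lambda>\<phi>. (cos \<phi>)\<^sup>2 * cos (z * cos \<phi>)) = Bessel_J0 z - Bessel_J1 z / z"
  proof -
    have "integral {0..pi / 2} (\<lambda>\<phi>. cos (z * cos \<phi>) - (sin \<phi>)\<^sup>2 * cos (z * cos \<phi>))
       = integral {0..pi / 2} (\<lambda>\<phi>. cos (z * cos \<phi>)) - integral {0..pi / 2} (\<lambda>\<phi>. (sin \<phi>)\<^sup>2 * cos (z * cos \<phi>))"
      by (intro integral_diff integrable_continuous_real continuous_intros)
    moreover have "(\<lambda>\<phi>. cos (z * cos \<phi>) - (sin \<phi>)\<^sup>2 * cos (z * cos \<phi>)) = (\<lambda>\<phi>. (cos \<phi>)\<^sup>2 * cos (z * cos \<phi>))"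
      by (simp add: cos_squared_eq algebra_simps)
    ultimately show ?thesis
      using avg_sin_square [OF assms] by (simp add: Bessel_J0_def avg_def right_diff_distrib)
  qed
  ultimately show ?thesis by (simp add: Bessel_J1_def [abs_def])
qed

text \<open>
With \<open>j = \<surd>z J\<^sub>0\<close> one has \<open>\<surd>z J\<^sub>1 = j/(2z) - j'\<close>, so the combination equals
\<open>j + 5 j'/(6z) - 5 j/(12z\<^sup>2)\<close>. The three estimates of \<open>Bessel_type_asymptotics\<close> contribute
\<open>5/32\<close>, \<open>5/24\<close> and \<open>5/12\<close>, whose sum is \<open>25/32\<close>.
\<close>

lemma Bessel_combination_asymptotics:
  assumes z: "0 < z"
  defines "\<alpha> \<equiv> sqrt (2 / pi)"
  shows "\<bar>sqrt z * (Bessel_J0 z - 5 / 6 * (Bessel_J1 z / z))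
     - \<alpha> * (cos (z - pi / 4) - 17 / (24 * z) * sin (z - pi / 4))\<bar> \<le> 25 * \<alpha> / (32 * z\<^sup>2)"
proof -
  define j where "j w = sqrt w * Bessel_J0 w" for w
  define j' where "j' w = Bessel_J0 w / (2 * sqrt w) - sqrt w * Bessel_J1 w" for w
  have dj: "(j has_real_derivative j' w) (at w)" if "0 < w" for w
    unfolding j_def [abs_def] j'_def using that
    by (auto intro!: derivative_eq_intros Bessel_J0_deriv simp: field_simps)
  have dj': "(j' has_real_derivative - (1 + 1 / (4 * w\<^sup>2)) * j w) (at w)" if w: "0 < w" for w
  proof -
    define s where "s = sqrt w"
    have s: "0 < s" "w = s\<^sup>2" using w by (auto simp: s_def)
    have e: "inverse s / (4 * (s * s)) = 1 / (4 * s ^ 3)"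
      using s(1) by (simp add: divide_simps power3_eq_cube)
    have "((\<lambda>w. 1 / (2 * sqrt w)) has_real_derivative - 1 / (4 * s ^ 3)) (at w)"
      using w s(1) by (auto intro!: derivative_eq_intros simp: s_def [symmetric] e)
    moreover have "(sqrt has_real_derivative 1 / (2 * s)) (at w)"
      using DERIV_real_sqrt [OF w] by (simp add: s_def field_simps)
    ultimately have "((\<lambda>w. Bessel_J0 w * (1 / (2 * sqrt w)) - sqrt w * Bessel_J1 w) has_real_derivative
       (- Bessel_J1 w * (1 / (2 * sqrt w)) + (- 1 / (4 * s ^ 3)) * Bessel_J0 w)
       - (1 / (2 * s) * Bessel_J1 w + (Bessel_J0 w - Bessel_J1 w / w) * sqrt w)) (at w)"
      using w by (intro DERIV_diff DERIV_mult' Bessel_J0_deriv Bessel_J1_deriv DERIV_mult) auto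
    moreover have "(- Bessel_J1 w * (1 / (2 * sqrt w)) + (- 1 / (4 * s ^ 3)) * Bessel_J0 w)
       - (1 / (2 * s) * Bessel_J1 w + (Bessel_J0 w - Bessel_J1 w / w) * sqrt w)
       = - (1 + 1 / (4 * w\<^sup>2)) * j w"
      unfolding j_def s_def [symmetric] unfolding s(2) using s(1)
      by (simp add: field_simps power2_eq_square power3_eq_cube)
    ultimately show ?thesis unfolding j'_def [abs_def] by simp
  qed
  note lims = Bessel_limits [folded \<alpha>_def]
  have "((\<lambda>w. Bessel_J0 w / (2 * sqrt w)) \<longlongrightarrow> 0) at_top"
  proof (rule Lim_null_comparison)
    show "((\<lambda>w. (1 / 2) / sqrt w) \<longlongrightarrow> 0) at_top"
      by (rule filterlim_compose [OF const_over_at_top sqrt_at_top])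
    show "\<forall>\<^sub>F w in at_top. norm (Bessel_J0 w / (2 * sqrt w)) \<le> 1 / 2 / sqrt w"
      using eventually_gt_at_top [of 0]
    proof (rule eventually_mono)
      fix w :: real assume w: "0 < w"
      have "\<bar>Bessel_J0 w\<bar> \<le> 1" unfolding Bessel_J0_def
        by (rule avg_le) (auto intro!: continuous_intros)
      then show "norm (Bessel_J0 w / (2 * sqrt w)) \<le> 1 / 2 / sqrt w"
        using w by (simp add: abs_mult divide_right_mono)
    qed
  qed
  from tendsto_diff [OF this lims(2)]
  have lim': "((\<lambda>w. j' w + \<alpha> * sin (w - pi / 4)) \<longlongrightarrow> 0) at_top"
    by (simp add: j'_def algebra_simps)
  have lim: "((\<lambda>w. j w - \<alpha> * cos (w - pi / 4)) \<longlongrightarrow> 0) at_top"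
    using lims(1) by (simp add: j_def)
  have \<alpha>: "0 \<le> \<alpha>" by (simp add: \<alpha>_def)
  note b = Bessel_type_asymptotics [OF dj dj' lim lim' \<alpha> z]
  define c s where "c = cos (z - pi / 4)" and "s = sin (z - pi / 4)"
  define X where "X = j z - (\<alpha> * c + \<alpha> / (8 * z) * s)"
  define Y where "Y = j' z + \<alpha> * s"
  have X: "\<bar>X\<bar> \<le> 5 * \<alpha> / (32 * z\<^sup>2)" using b(3) by (simp add: X_def c_def s_def)
  have "\<bar>Y\<bar> \<le> \<alpha> / (4 * z)" using b(2) by (simp add: Y_def s_def)
  then have "5 / (6 * z) * \<bar>Y\<bar> \<le> 5 / (6 * z) * (\<alpha> / (4 * z))" using z by (intro mult_left_mono) auto
  then have Y: "\<bar>5 / (6 * z) * Y\<bar> \<le> 5 / (6 * z) * (\<alpha> / (4 * z))" using z by (simp add: abs_mult)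
  have "5 / (12 * z\<^sup>2) * \<bar>j z\<bar> \<le> 5 / (12 * z\<^sup>2) * \<alpha>" using b(1) by (intro mult_left_mono) auto
  then have Z: "\<bar>5 / (12 * z\<^sup>2) * j z\<bar> \<le> 5 / (12 * z\<^sup>2) * \<alpha>" by (simp add: abs_mult)
  have "sqrt z * Bessel_J1 z = j z / (2 * z) - j' z"
  proof -
    have "Bessel_J0 z / (2 * sqrt z) = sqrt z * Bessel_J0 z / (2 * z)"
      using z by (simp add: field_simps)
    then show ?thesis by (simp add: j_def j'_def)
  qed
  moreover have "sqrt z * (Bessel_J0 z - 5 / 6 * (Bessel_J1 z / z)) = j z - 5 / (6 * z) * (sqrt z * Bessel_J1 z)"
    by (simp add: j_def right_diff_distrib)
  ultimately have "sqrt z * (Bessel_J0 z - 5 / 6 * (Bessel_J1 z / z)) = j z - 5 / (6 * z) * (j z / (2 * z) - j' z)"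
    by (simp only:)
  also have "\<dots> - \<alpha> * (c - 17 / (24 * z) * s) = X + 5 / (6 * z) * Y - 5 / (12 * z\<^sup>2) * j z"
    using z by (simp add: X_def Y_def field_simps power2_eq_square)
  also have "\<bar>\<dots>\<bar> \<le> \<bar>X\<bar> + \<bar>5 / (6 * z) * Y\<bar> + \<bar>5 / (12 * z\<^sup>2) * j z\<bar>" by linarith
  also have "\<dots> \<le> 5 * \<alpha> / (32 * z\<^sup>2) + 5 / (6 * z) * (\<alpha> / (4 * z)) + 5 / (12 * z\<^sup>2) * \<alpha>"
    by (intro add_mono X Y Z)
  also have "\<dots> = 25 * \<alpha> / (32 * z\<^sup>2)" using z by (simp add: field_simps power2_eq_square)
  finally show ?thesis by (simp only: c_def s_def)
qed

section \<open>Endpoint remainders\<close>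

text \<open>
This supplies continuity at \<open>c = 0\<close> of quotients such as \<open>f(c)/c\<close>, which take the value \<open>0\<close> there
because \<open>x / 0 = 0\<close>.
\<close>

lemma continuous_on_unit_of_linear_bound:
  fixes q :: "real \<Rightarrow> real"
  assumes "\<And>c. 0 < c \<Longrightarrow> c \<le> 1 \<Longrightarrow> isCont q c" and "\<And>c. 0 \<le> c \<Longrightarrow> c \<le> 1 \<Longrightarrow> \<bar>q c\<bar> \<le> c"
  shows "continuous_on {0..1} q"
  unfolding continuous_on_eq_continuous_within
proof
  fix c :: real assume c: "c \<in> {0..1}"
  show "continuous (at c within {0..1}) q"
  proof (cases "c = 0")
    case True
    have "q 0 = 0" using assms(2) [of 0] by simp
    moreover have "(q \<longlongrightarrow> 0) (at 0 within {0..1})"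
    proof (rule Lim_null_comparison)
      show "\<forall>\<^sub>F x in at 0 within {0..1}. norm (q x) \<le> x"
        unfolding eventually_at_filter using assms(2) by (auto intro!: always_eventually)
    qed (auto intro!: tendsto_eq_intros)
    ultimately show ?thesis using True by (simp add: continuous_within)
  next
    case False
    then show ?thesis using assms(1) [of c] c by (auto intro: continuous_at_imp_continuous_within)
  qed
qed

lemma exp_minus_bounds:
  fixes x :: real
  assumes "0 \<le> x"
  shows "1 - x \<le> exp (- x)" "exp (- x) \<le> 1 - x + x\<^sup>2 / 2"
    and "1 - x + x\<^sup>2 / 2 - x ^ 3 / 6 \<le> exp (- x)"
proof -
  show 1: "1 - x \<le> exp (- x)" for x :: real using exp_ge_add_one_self [of "- x"] by simp
  have 2: "exp (- x) \<le> 1 - x + x\<^sup>2 / 2" if "0 \<le> x" for x :: real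
  proof -
    have "1 - 0 + 0\<^sup>2 / 2 - exp (- 0) \<le> 1 - x + x\<^sup>2 / 2 - exp (- x)"
    proof (rule DERIV_nonneg_imp_nondecreasing [OF that])
      fix s :: real
      show "\<exists>y. ((\<lambda>x. 1 - x + x\<^sup>2 / 2 - exp (- x)) has_real_derivative y) (at s) \<and> 0 \<le> y"
        by (rule exI [of _ "- 1 + s + exp (- s)"]) (use 1 [of s] in \<open>auto intro!: derivative_eq_intros\<close>)
    qed
    then show ?thesis by simp
  qed
  then show "exp (- x) \<le> 1 - x + x\<^sup>2 / 2" using assms .
  have "exp (- 0) - (1 - 0 + 0\<^sup>2 / 2 - 0 ^ 3 / 6) \<le> exp (- x) - (1 - x + x\<^sup>2 / 2 - x ^ 3 / 6)"
  proof (rule DERIV_nonneg_imp_nondecreasing [OF assms])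
    fix s :: real assume "0 \<le> s"
    then show "\<exists>y. ((\<lambda>x. exp (- x) - (1 - x + x\<^sup>2 / 2 - x ^ 3 / 6)) has_real_derivative y) (at s) \<and> 0 \<le> y"
      by (intro exI [of _ "1 - s + s\<^sup>2 / 2 - exp (- s)"]) (use 2 [of s] in \<open>auto intro!: derivative_eq_intros simp: power2_eq_square\<close>)
  qed
  then show "1 - x + x\<^sup>2 / 2 - x ^ 3 / 6 \<le> exp (- x)" by simp
qed

lemma exp_minus_half_square_bounds:
  fixes c :: real
  defines "E \<equiv> exp (- c\<^sup>2 / 2)"
  shows "1 - c\<^sup>2 / 2 \<le> E" "E \<le> 1 - c\<^sup>2 / 2 + c ^ 4 / 8" "1 - c\<^sup>2 / 2 + c ^ 4 / 8 - c ^ 6 / 48 \<le> E" "E \<le> 1"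
  using exp_minus_bounds [of "c\<^sup>2 / 2"] by (simp_all add: E_def power_divide flip: power_mult)

text \<open>
The amplitude \<open>f(c) = exp(- c\<^sup>2/2) - 1 + c\<^sup>2/2\<close>, \<open>c = sin \<phi>\<close>, vanishes to fourth order at \<open>\<phi> = 0\<close>, so two
integrations by parts, each dividing by \<open>\<kappa> sin \<phi>\<close>, leave a bounded integrand over \<open>\<kappa>\<^sup>2\<close>. The
functions \<open>q = f/c\<close> and \<open>m = q'/c\<close> are the successive amplitudes, and the remaining integrand is
\<open>(cos\<^sup>2 \<phi> m'(c) - c m(c)) cos(\<kappa> cos \<phi>)\<close>. Both \<open>cos\<^sup>2 \<phi> m'(c)\<close> and \<open>c m(c)\<close> lie in \<open>[0, 3/8]\<close>,
so their difference is at most \<open>3/8\<close> in absolute value.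
\<close>

lemma fourth_order_cos_average_le:
  assumes \<kappa>: "0 < \<kappa>"
  shows "\<bar>avg (\<lambda>\<phi>. (exp (- (sin \<phi>)\<^sup>2 / 2) - 1 + (sin \<phi>)\<^sup>2 / 2) * cos (\<kappa> * cos \<phi>))\<bar> \<le> 3 / (8 * \<kappa>\<^sup>2)"
proof -
  define E where "E c = exp (- c\<^sup>2 / 2)" for c :: real
  define f where "f c = E c - 1 + c\<^sup>2 / 2" for c
  define q where "q c = f c / c" for c
  define m where "m c = (1 - E c) / c - f c / c ^ 3" for c
  define m' where "m' c = E c - 2 * (1 - E c) / c\<^sup>2 + 3 * f c / c ^ 4" for c
  have dE: "(E has_real_derivative - c * E c) (at c)" for c
    unfolding E_def [abs_def] by (auto intro!: derivative_eq_intros)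
  have df: "(f has_real_derivative c * (1 - E c)) (at c)" for c
    unfolding f_def [abs_def] by (auto intro!: derivative_eq_intros dE simp: algebra_simps)
  have dq: "(q has_real_derivative c * m c) (at c)" if "0 < c" for c
    unfolding q_def [abs_def] m_def using that
    by (auto intro!: derivative_eq_intros df) (simp add: field_simps power2_eq_square power3_eq_cube)
  have dm: "(m has_real_derivative m' c) (at c)" if "0 < c" for c
    unfolding m_def [abs_def] m'_def using that
    by (auto intro!: derivative_eq_intros df dE) (simp add: field_simps eval_nat_numeral)
  have fb: "0 \<le> f c" "f c \<le> c ^ 4 / 8" "c ^ 4 / 8 - c ^ 6 / 48 \<le> f c" for c
    using exp_minus_half_square_bounds [of c] by (simp_all add: f_def E_def)
  have pw: "c ^ 4 \<le> c\<^sup>2" "c ^ 6 \<le> c ^ 4" "0 \<le> c ^ 6" if "0 \<le> c" "c \<le> 1" for c :: real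
    using that by (auto intro!: power_decreasing)
  have cm: "0 \<le> c * m c" "c * m c \<le> 3 / 8 * c\<^sup>2" if c: "0 < c" "c \<le> 1" for c
  proof -
    have cm: "c * m c = (1 - E c) - f c / c\<^sup>2"
    proof -
      have "c * m c = c * ((1 - E c) / c) - c * (f c / c ^ 3)" by (simp only: m_def right_diff_distrib)
      then show ?thesis using c by (simp add: power2_eq_square power3_eq_cube)
    qed
    have "f c / c\<^sup>2 \<le> (c ^ 4 / 8) / c\<^sup>2" "(c ^ 4 / 8 - c ^ 6 / 48) / c\<^sup>2 \<le> f c / c\<^sup>2"
      by (intro divide_right_mono fb, simp)+
    moreover have "(c ^ 4 / 8) / c\<^sup>2 = c\<^sup>2 / 8" "(c ^ 4 / 8 - c ^ 6 / 48) / c\<^sup>2 = c\<^sup>2 / 8 - c ^ 4 / 48"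
      using c by (simp_all add: field_simps power_eq_if)
    ultimately show "0 \<le> c * m c" "c * m c \<le> 3 / 8 * c\<^sup>2"
      using exp_minus_half_square_bounds [of c, folded E_def] pw [of c] c unfolding cm by linarith+
  qed
  have m': "0 \<le> m' c" "m' c \<le> 3 / 8" if c: "0 < c" "c \<le> 1" for c
  proof -
    have u: "1 - E c \<le> c\<^sup>2 / 2 - c ^ 4 / 8 + c ^ 6 / 48" "c\<^sup>2 / 2 - c ^ 4 / 8 \<le> 1 - E c"
      using exp_minus_half_square_bounds [of c, folded E_def] by linarith+
    have "(1 - E c) / c\<^sup>2 \<le> (c\<^sup>2 / 2 - c ^ 4 / 8 + c ^ 6 / 48) / c\<^sup>2" "(c\<^sup>2 / 2 - c ^ 4 / 8) / c\<^sup>2 \<le> (1 - E c) / c\<^sup>2"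
      by (intro divide_right_mono u, simp)+
    moreover have "(c\<^sup>2 / 2 - c ^ 4 / 8 + c ^ 6 / 48) / c\<^sup>2 = 1 / 2 - c\<^sup>2 / 8 + c ^ 4 / 48"
      "(c\<^sup>2 / 2 - c ^ 4 / 8) / c\<^sup>2 = 1 / 2 - c\<^sup>2 / 8"
      using c by (simp_all add: field_simps power_eq_if)
    moreover have "f c / c ^ 4 \<le> (c ^ 4 / 8) / c ^ 4" "(c ^ 4 / 8 - c ^ 6 / 48) / c ^ 4 \<le> f c / c ^ 4"
      by (intro divide_right_mono fb, simp)+
    moreover have "(c ^ 4 / 8) / c ^ 4 = 1 / 8" "(c ^ 4 / 8 - c ^ 6 / 48) / c ^ 4 = 1 / 8 - c\<^sup>2 / 48"
      using c by (simp_all add: field_simps power_eq_if)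
    moreover have "m' c = E c - 2 * ((1 - E c) / c\<^sup>2) + 3 * (f c / c ^ 4)" by (simp add: m'_def)
    moreover have "c\<^sup>2 \<le> 1" using c by (simp add: power_le_one)
    ultimately show "0 \<le> m' c" "m' c \<le> 3 / 8"
      using exp_minus_half_square_bounds [of c, folded E_def] pw [of c] c by linarith+
  qed
  have cont_q: "continuous_on {0..1} q"
  proof (rule continuous_on_unit_of_linear_bound)
    fix c :: real assume c: "0 \<le> c" "c \<le> 1"
    have "f c \<le> c\<^sup>2" using fb [of c] pw [OF c] zero_le_power2 [of c] by linarith
    then show "\<bar>q c\<bar> \<le> c" using fb(1) [of c] c by (cases "c = 0") (auto simp: q_def divide_le_eq power2_eq_square)
  qed (use dq DERIV_isCont in blast)
  have cont_m: "continuous_on {0..1} m"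
  proof (rule continuous_on_unit_of_linear_bound)
    fix c :: real assume c: "0 \<le> c" "c \<le> 1"
    show "\<bar>m c\<bar> \<le> c"
    proof (cases "c = 0")
      case False
      then have "0 \<le> c * m c" "c * m c \<le> c * c" using cm [of c] c zero_le_power2 [of c] by (auto simp: power2_eq_square)
      then show ?thesis using c False by (simp add: zero_le_mult_iff)
    qed (simp add: m_def)
  qed (use dm DERIV_isCont in blast)
  have rng: "sin ` {0..pi / 2} \<subseteq> {0..1::real}" by (auto intro!: sin_ge_zero)
  have cont_qm: "continuous_on {0..pi / 2} (\<lambda>\<phi>. q (sin \<phi>))" "continuous_on {0..pi / 2} (\<lambda>\<phi>. m (sin \<phi>))"
    by (rule continuous_on_compose2 [OF _ _ rng], rule cont_q cont_m, intro continuous_intros)+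
  define A where "A \<phi> = cos \<phi> * m (sin \<phi>) * cos (\<kappa> * cos \<phi>) / \<kappa>\<^sup>2 - q (sin \<phi>) * sin (\<kappa> * cos \<phi>) / \<kappa>" for \<phi>
  have "\<bar>avg (\<lambda>\<phi>. f (sin \<phi>) * cos (\<kappa> * cos \<phi>))\<bar> \<le> 3 / (8 * \<kappa>\<^sup>2)"
  proof (rule abs_avg_le_of_approximate_antiderivative [where A = A and
        e = "\<lambda>\<phi>. ((cos \<phi>)\<^sup>2 * m' (sin \<phi>) - sin \<phi> * m (sin \<phi>)) * cos (\<kappa> * cos \<phi>) / \<kappa>\<^sup>2"])
    show "continuous_on {0..pi / 2} (\<lambda>\<phi>. f (sin \<phi>) * cos (\<kappa> * cos \<phi>))"
      unfolding f_def E_def by (intro continuous_intros) auto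
    show "continuous_on {0..pi / 2} A"
      unfolding A_def using \<kappa> by (intro continuous_intros cont_qm) auto
    show "A (pi / 2) = A 0" by (simp add: A_def q_def m_def)
    fix \<phi> :: real assume p: "0 < \<phi>" "\<phi> < pi / 2"
    have s: "0 < sin \<phi>" "sin \<phi> \<le> 1" using p by (auto intro!: sin_gt_zero)
    have dqs: "((\<lambda>\<phi>. q (sin \<phi>)) has_real_derivative sin \<phi> * m (sin \<phi>) * cos \<phi>) (at \<phi>)"
      by (rule DERIV_chain2 [OF dq [OF s(1)] DERIV_sin])
    have dms: "((\<lambda>\<phi>. m (sin \<phi>)) has_real_derivative m' (sin \<phi>) * cos \<phi>) (at \<phi>)"
      by (rule DERIV_chain2 [OF dm [OF s(1)] DERIV_sin])
    have qf: "f (sin \<phi>) = q (sin \<phi>) * sin \<phi>" using s by (simp add: q_def)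
    show "(A has_real_derivative f (sin \<phi>) * cos (\<kappa> * cos \<phi>)
        + ((cos \<phi>)\<^sup>2 * m' (sin \<phi>) - sin \<phi> * m (sin \<phi>)) * cos (\<kappa> * cos \<phi>) / \<kappa>\<^sup>2) (at \<phi>)"
      unfolding A_def [abs_def] qf using \<kappa>
      by (auto intro!: derivative_eq_intros dqs dms) (simp add: field_simps eval_nat_numeral)
    have "\<bar>(cos \<phi>)\<^sup>2 * m' (sin \<phi>) - sin \<phi> * m (sin \<phi>)\<bar> \<le> 3 / 8"
    proof -
      have "(cos \<phi>)\<^sup>2 * m' (sin \<phi>) \<le> 1 * (3 / 8)"
        using m' [OF s] by (intro mult_mono) (auto simp: abs_square_le_1)
      moreover have "0 \<le> (cos \<phi>)\<^sup>2 * m' (sin \<phi>)" using m' [OF s] by simp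
      moreover have "(sin \<phi>)\<^sup>2 \<le> 1" by (simp add: abs_square_le_1)
      ultimately show ?thesis using cm [OF s] by linarith
    qed
    then have "\<bar>((cos \<phi>)\<^sup>2 * m' (sin \<phi>) - sin \<phi> * m (sin \<phi>)) * cos (\<kappa> * cos \<phi>)\<bar> \<le> 3 / 8 * 1"
      unfolding abs_mult by (intro mult_mono) auto
    then have "\<bar>((cos \<phi>)\<^sup>2 * m' (sin \<phi>) - sin \<phi> * m (sin \<phi>)) * cos (\<kappa> * cos \<phi>)\<bar> / \<kappa>\<^sup>2 \<le> 3 / 8 * 1 / \<kappa>\<^sup>2"
      by (rule divide_right_mono) simp
    then show "\<bar>((cos \<phi>)\<^sup>2 * m' (sin \<phi>) - sin \<phi> * m (sin \<phi>)) * cos (\<kappa> * cos \<phi>) / \<kappa>\<^sup>2\<bar> \<le> 3 / (8 * \<kappa>\<^sup>2)"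
      by (simp add: abs_divide)
  qed
  then show ?thesis by (simp add: f_def E_def)
qed

text \<open>
Here one integration by parts suffices, because the estimate is used with a further factor \<open>1/\<kappa>\<close>.
The remaining integrand is a difference of two terms in \<open>[0, 1/8]\<close>, where
\<open>cos\<^sup>2 \<phi> sin\<^sup>2 \<phi> \<le> 1/4\<close> is used for the first.
\<close>

lemma fourth_order_sin_average_le:
  assumes \<kappa>: "0 < \<kappa>"
  shows "\<bar>avg (\<lambda>\<phi>. cos \<phi> * (1 - (1 + (sin \<phi>)\<^sup>2 / 2) * exp (- (sin \<phi>)\<^sup>2 / 2)) * sin (\<kappa> * cos \<phi>))\<bar> \<le> 1 / (8 * \<kappa>)"
proof -
  define E where "E c = exp (- c\<^sup>2 / 2)" for c :: real
  define f where "f c = 1 - (1 + c\<^sup>2 / 2) * E c" for c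
  define p where "p c = f c / c" for c
  define p' where "p' c = c\<^sup>2 * E c / 2 - f c / c\<^sup>2" for c
  have dE: "(E has_real_derivative - c * E c) (at c)" for c
    unfolding E_def [abs_def] by (auto intro!: derivative_eq_intros)
  have df: "(f has_real_derivative c ^ 3 * E c / 2) (at c)" for c
    unfolding f_def [abs_def] by (auto intro!: derivative_eq_intros dE) (simp add: field_simps eval_nat_numeral)
  have dp: "(p has_real_derivative p' c) (at c)" if "0 < c" for c
    unfolding p_def [abs_def] p'_def using that
    by (auto intro!: derivative_eq_intros df) (simp add: field_simps power2_eq_square power3_eq_cube)
  have fb: "0 \<le> f c" "f c \<le> c ^ 4 / 8" if c: "0 \<le> c" "c \<le> 1" for c
  proof -
    have c2: "c\<^sup>2 \<le> 1" using c by (simp add: power_le_one)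
    have "(1 + c\<^sup>2 / 2) * E c \<le> (1 + c\<^sup>2 / 2) * (1 - c\<^sup>2 / 2 + c ^ 4 / 8)"
      using exp_minus_half_square_bounds [of c, folded E_def] by (intro mult_left_mono) auto
    also have "\<dots> = 1 - c ^ 4 / 8 + c\<^sup>2 * c ^ 4 / 16"
      by (simp add: algebra_simps power2_eq_square power4_eq_xxxx)
    also have "\<dots> \<le> 1" using mult_right_mono [OF c2, of "c ^ 4"] zero_le_power [OF c(1), of 4] by linarith
    finally show "0 \<le> f c" by (simp add: f_def)
    have "1 - c ^ 4 / 8 \<le> 1 - c ^ 4 / 8 + c ^ 4 * (c\<^sup>2 / 24 * (1 - c\<^sup>2 / 4))"
      using c2 c by simp
    also have "\<dots> = (1 + c\<^sup>2 / 2) * (1 - c\<^sup>2 / 2 + c ^ 4 / 8 - c ^ 6 / 48)"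
      by (simp add: field_simps eval_nat_numeral)
    also have "\<dots> \<le> (1 + c\<^sup>2 / 2) * E c"
      using exp_minus_half_square_bounds [of c, folded E_def] by (intro mult_left_mono) auto
    finally show "f c \<le> c ^ 4 / 8" by (simp add: f_def)
  qed
  have p'b: "0 \<le> p' c" "p' c \<le> c\<^sup>2 / 2" if c: "0 < c" "c \<le> 1" for c
  proof -
    have "c\<^sup>2 \<le> 1" using c by (simp add: power_le_one)
    then have b: "1 / 2 \<le> E c" "E c \<le> 1" using exp_minus_half_square_bounds [of c, folded E_def] by linarith+
    have "c\<^sup>2 * (1 / 2) \<le> c\<^sup>2 * E c" by (rule mult_left_mono [OF b(1)]) simp
    moreover have "c\<^sup>2 * E c \<le> c\<^sup>2 * 1" by (rule mult_left_mono [OF b(2)]) simp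
    moreover have "f c / c\<^sup>2 \<le> (c ^ 4 / 8) / c\<^sup>2" using fb(2) [of c] c by (intro divide_right_mono) auto
    moreover have "(c ^ 4 / 8) / c\<^sup>2 = c\<^sup>2 / 8" using c by (simp add: field_simps power_eq_if)
    moreover have "0 \<le> f c / c\<^sup>2" using fb(1) [of c] c by simp
    ultimately show "0 \<le> p' c" "p' c \<le> c\<^sup>2 / 2" unfolding p'_def using zero_le_power2 [of c] by linarith+
  qed
  have cont_p: "continuous_on {0..1} p"
  proof (rule continuous_on_unit_of_linear_bound)
    fix c :: real assume c: "0 \<le> c" "c \<le> 1"
    have "c ^ 4 \<le> c\<^sup>2" using c by (intro power_decreasing) auto
    then have "f c \<le> c\<^sup>2" using fb [OF c] zero_le_power2 [of c] by linarith
    then show "\<bar>p c\<bar> \<le> c" using fb(1) [OF c] c by (cases "c = 0") (auto simp: p_def divide_le_eq power2_eq_square)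
  qed (use dp DERIV_isCont in blast)
  have rng: "sin ` {0..pi / 2} \<subseteq> {0..1::real}" by (auto intro!: sin_ge_zero)
  have cont_ps: "continuous_on {0..pi / 2} (\<lambda>\<phi>. p (sin \<phi>))"
    by (rule continuous_on_compose2 [OF cont_p _ rng]) (intro continuous_intros)
  define A where "A \<phi> = cos \<phi> * p (sin \<phi>) * cos (\<kappa> * cos \<phi>) / \<kappa>" for \<phi>
  have "\<bar>avg (\<lambda>\<phi>. cos \<phi> * f (sin \<phi>) * sin (\<kappa> * cos \<phi>))\<bar> \<le> 1 / (8 * \<kappa>)"
  proof (rule abs_avg_le_of_approximate_antiderivative [where A = A and
        e = "\<lambda>\<phi>. ((cos \<phi>)\<^sup>2 * p' (sin \<phi>) - f (sin \<phi>)) * cos (\<kappa> * cos \<phi>) / \<kappa>"])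
    show "continuous_on {0..pi / 2} (\<lambda>\<phi>. cos \<phi> * f (sin \<phi>) * sin (\<kappa> * cos \<phi>))"
      unfolding f_def E_def by (intro continuous_intros) auto
    show "continuous_on {0..pi / 2} A"
      unfolding A_def using \<kappa> by (intro continuous_intros cont_ps) auto
    show "A (pi / 2) = A 0" by (simp add: A_def p_def)
    fix \<phi> :: real assume r: "0 < \<phi>" "\<phi> < pi / 2"
    have s: "0 < sin \<phi>" "sin \<phi> \<le> 1" using r by (auto intro!: sin_gt_zero)
    have dps: "((\<lambda>\<phi>. p (sin \<phi>)) has_real_derivative p' (sin \<phi>) * cos \<phi>) (at \<phi>)"
      by (rule DERIV_chain2 [OF dp [OF s(1)] DERIV_sin])
    have pf: "f (sin \<phi>) = p (sin \<phi>) * sin \<phi>" using s by (simp add: p_def)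
    show "(A has_real_derivative cos \<phi> * f (sin \<phi>) * sin (\<kappa> * cos \<phi>)
        + ((cos \<phi>)\<^sup>2 * p' (sin \<phi>) - f (sin \<phi>)) * cos (\<kappa> * cos \<phi>) / \<kappa>) (at \<phi>)"
      unfolding A_def [abs_def] pf using \<kappa>
      by (auto intro!: derivative_eq_intros dps) (simp add: field_simps eval_nat_numeral)
    have "\<bar>(cos \<phi>)\<^sup>2 * p' (sin \<phi>) - f (sin \<phi>)\<bar> \<le> 1 / 8"
    proof -
      have "(cos \<phi>)\<^sup>2 * p' (sin \<phi>) \<le> (cos \<phi>)\<^sup>2 * ((sin \<phi>)\<^sup>2 / 2)"
        using p'b [OF s] by (intro mult_left_mono) auto
      also have "\<dots> = (1 - (sin \<phi>)\<^sup>2) * (sin \<phi>)\<^sup>2 / 2" by (simp add: cos_squared_eq)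
      also have "\<dots> \<le> 1 / 8"
        using zero_le_power2 [of "(sin \<phi>)\<^sup>2 - 1 / 2"] by (simp add: power2_diff algebra_simps power2_eq_square)
      finally have "(cos \<phi>)\<^sup>2 * p' (sin \<phi>) \<le> 1 / 8" .
      moreover have "0 \<le> (cos \<phi>)\<^sup>2 * p' (sin \<phi>)" using p'b [OF s] by simp
      moreover have "(sin \<phi>) ^ 4 \<le> 1" using s by (simp add: power_le_one)
      ultimately show ?thesis using fb [of "sin \<phi>"] s by linarith
    qed
    then have "\<bar>((cos \<phi>)\<^sup>2 * p' (sin \<phi>) - f (sin \<phi>)) * cos (\<kappa> * cos \<phi>)\<bar> \<le> 1 / 8 * 1"
      unfolding abs_mult by (intro mult_mono) auto
    then have "\<bar>((cos \<phi>)\<^sup>2 * p' (sin \<phi>) - f (sin \<phi>)) * cos (\<kappa> * cos \<phi>)\<bar> / \<kappa> \<le> 1 / 8 * 1 / \<kappa>"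
      using \<kappa> by (intro divide_right_mono) simp_all
    then show "\<bar>((cos \<phi>)\<^sup>2 * p' (sin \<phi>) - f (sin \<phi>)) * cos (\<kappa> * cos \<phi>) / \<kappa>\<bar> \<le> 1 / (8 * \<kappa>)"
      using \<kappa> by (simp add: abs_divide)
  qed
  then show ?thesis by (simp add: f_def E_def)
qed

section \<open>The asymptotic formula\<close>

lemma exp_half_le: "exp (1 / 2) \<le> (33 / 20 :: real)"
proof -
  have "(exp (1 / 2 :: real))\<^sup>2 = exp 1" by (simp add: power2_eq_square flip: exp_add)
  also have "\<dots> \<le> (33 / 20)\<^sup>2" using e_less_272 by (simp add: power2_eq_square)
  finally show ?thesis by (rule power2_le_imp_le) simp
qed

lemma exp_chord_le:
  fixes y :: real
  assumes "0 \<le> y" "y \<le> 1"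
  shows "exp (y / 2) \<le> 1 + 13 / 20 * y"
proof -
  have "exp ((1 - y) *\<^sub>R 0 + y *\<^sub>R (1 / 2)) \<le> (1 - y) * exp 0 + y * exp (1 / 2 :: real)"
    by (rule convex_onD [OF exp_convex]) (use assms in auto)
  also have "\<dots> \<le> (1 - y) * 1 + y * (33 / 20)"
    using assms exp_half_le by (intro add_mono mult_left_mono) auto
  finally show ?thesis by simp
qed

text \<open>
The pointwise error of \<open>perturbed_cos_approx\<close> is multiplied by \<open>exp(t\<^sup>2/2)\<close>, majorised by an even
polynomial in \<open>t\<close>, and averaged with the Wallis integrals. The result is about \<open>0.6096/\<kappa>\<^sup>2\<close>.
\<close>

lemma Laguerre_near_oscillating_average:
  assumes "1 \<le> n"
  defines "\<kappa> \<equiv> 2 * sqrt (real n)"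
  shows "\<bar>Laguerre n 1 - avg (\<lambda>\<phi>. exp ((cos \<phi>)\<^sup>2 / 2)
      * (cos (\<kappa> * cos \<phi>) - (cos \<phi> - cos \<phi> ^ 3 / 3) / (2 * \<kappa>) * sin (\<kappa> * cos \<phi>)))\<bar> \<le> 61 / 100 / \<kappa>\<^sup>2"
proof -
  have "1 \<le> sqrt (real n)" using assms(1) by simp
  then have \<kappa>: "2 \<le> \<kappa>" by (simp add: \<kappa>_def)
  have \<kappa>2: "\<kappa>\<^sup>2 = 4 * real n" by (simp add: \<kappa>_def power_mult_distrib)
  obtain p' where p': "\<And>t. (even_hermite n has_real_derivative p' t) (at t)"
    "\<And>t. (p' has_real_derivative 2 * t * p' t - 4 * real n * even_hermite n t) (at t)" "p' 0 = 0"
    using even_hermite_ode [of n] by blast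
  define g where "g t = exp (- t\<^sup>2 / 2) * even_hermite n t" for t
  define g' where "g' t = exp (- t\<^sup>2 / 2) * (p' t - t * even_hermite n t)" for t
  have dE: "((\<lambda>t. exp (- t\<^sup>2 / 2)) has_real_derivative - t * exp (- t\<^sup>2 / 2)) (at t)" for t :: real
    by (auto intro!: derivative_eq_intros)
  have g: "(g has_real_derivative g' t) (at t)" for t
    unfolding g_def [abs_def] g'_def
    by (rule DERIV_cong [OF DERIV_mult [OF dE p'(1)]]) (simp add: algebra_simps)
  have "((\<lambda>t. p' t - t * even_hermite n t) has_real_derivative
      2 * t * p' t - 4 * real n * even_hermite n t - (1 * even_hermite n t + p' t * t)) (at t)" for t
    by (intro DERIV_diff p' DERIV_mult DERIV_ident)
  from DERIV_mult [OF dE this]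
  have g': "(g' has_real_derivative - (\<kappa>\<^sup>2 + 1 - t\<^sup>2) * g t) (at t)" for t
    unfolding g_def g'_def [abs_def]
    by (rule DERIV_cong) (simp add: algebra_simps power2_eq_square \<kappa>2 [unfolded power2_eq_square])
  have g0: "g 0 = 1" "g' 0 = 0"
  proof -
    have "even_hermite n 0 = (\<Sum>k\<le>n. if k = 0 then 1 else 0)"
      unfolding even_hermite_def by (rule sum.cong) auto
    then have "even_hermite n 0 = 1" by simp
    then show "g 0 = 1" "g' 0 = 0" by (simp_all add: g_def g'_def p')
  qed
  note approx = perturbed_cos_approx [OF \<kappa> g g' g0]
  define a where "a t = cos (\<kappa> * t) - (t - t ^ 3 / 3) / (2 * \<kappa>) * sin (\<kappa> * t)" for t
  \<comment> \<open>The product of the chord bound \<open>1 + 13/20 t\<^sup>2\<close> for the exponential and the bound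
    \<open>17/16 t\<^sup>2 - 5/16 t\<^sup>4\<close> for the error, the latter obtained from \<open>t\<^sup>6 \<le> t\<^sup>4\<close>.\<close>
  define P :: "real \<Rightarrow> real" where "P t = (17 / 16 * t ^ (2 * 1) + 121 / 320 * t ^ (2 * 2) - 13 / 64 * t ^ (2 * 3)) / \<kappa>\<^sup>2" for t
  have pointwise: "\<bar>even_hermite n t - exp (t\<^sup>2 / 2) * a t\<bar> \<le> P t" if t: "0 \<le> t" "t \<le> 1" for t
  proof -
    have t2: "t\<^sup>2 \<le> 1" using t by (simp add: power_le_one)
    have "even_hermite n t = exp (t\<^sup>2 / 2) * g t" by (simp add: g_def exp_minus)
    then have "\<bar>even_hermite n t - exp (t\<^sup>2 / 2) * a t\<bar> = exp (t\<^sup>2 / 2) * \<bar>g t - a t\<bar>"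
      by (simp add: abs_mult flip: right_diff_distrib)
    also have "\<dots> \<le> exp (t\<^sup>2 / 2) * ((t\<^sup>2 / 2 + 9 / 16 * (t - t ^ 3 / 3)\<^sup>2) / \<kappa>\<^sup>2)"
      using approx [OF t] by (intro mult_left_mono) (auto simp: a_def)
    also have "\<dots> \<le> (1 + 13 / 20 * t\<^sup>2) * ((17 / 16 * t\<^sup>2 - 5 / 16 * t ^ 4) / \<kappa>\<^sup>2)"
    proof (intro mult_mono divide_right_mono exp_chord_le t2)
      have "t ^ 4 * t\<^sup>2 \<le> t ^ 4 * 1" using t2 by (intro mult_left_mono) auto
      moreover have "(t - t ^ 3 / 3)\<^sup>2 = t\<^sup>2 - 2 / 3 * t ^ 4 + t ^ 4 * t\<^sup>2 / 9"
        by (simp add: field_simps eval_nat_numeral)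
      ultimately show "t\<^sup>2 / 2 + 9 / 16 * (t - t ^ 3 / 3)\<^sup>2 \<le> 17 / 16 * t\<^sup>2 - 5 / 16 * t ^ 4"
        by linarith
    qed auto
    also have "\<dots> = P t"
    proof -
      have "(1 + 13 / 20 * t\<^sup>2) * (17 / 16 * t\<^sup>2 - 5 / 16 * t ^ 4)
          = 17 / 16 * t ^ (2 * 1) + 121 / 320 * t ^ (2 * 2) - 13 / 64 * t ^ (2 * 3)"
        by (simp add: field_simps eval_nat_numeral)
      then show ?thesis unfolding P_def times_divide_eq_right by (simp only:)
    qed
    finally show ?thesis .
  qed
  have L: "Laguerre n 1 = avg (\<lambda>\<phi>. even_hermite n (cos \<phi>))"
    unfolding avg_def integral_unique [OF even_hermite_cos_has_integral] by simp
  have "((\<lambda>\<phi>. P (cos \<phi>)) has_integral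
     (17 / 16 * (pi / 2 * (real ((2 * 1) choose 1) / 4 ^ 1)) + 121 / 320 * (pi / 2 * (real ((2 * 2) choose 2) / 4 ^ 2))
      - 13 / 64 * (pi / 2 * (real ((2 * 3) choose 3) / 4 ^ 3))) / \<kappa>\<^sup>2) {0..pi / 2}"
    unfolding P_def
    by (intro has_integral_divide has_integral_diff has_integral_add has_integral_mult_right cospow_has_integral)
  then have "((\<lambda>\<phi>. P (cos \<phi>)) has_integral pi / 2 * (12484 / 20480 / \<kappa>\<^sup>2)) {0..pi / 2}"
    by (rule has_integral_eq_rhs) (simp add: eval_nat_numeral field_simps)
  then have "\<bar>avg (\<lambda>\<phi>. even_hermite n (cos \<phi>)) - avg (\<lambda>\<phi>. exp ((cos \<phi>)\<^sup>2 / 2) * a (cos \<phi>))\<bar>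
     \<le> 2 / pi * (pi / 2 * (12484 / 20480 / \<kappa>\<^sup>2))"
  proof (rule abs_avg_diff_le [rotated 2])
    show "continuous_on {0..pi / 2} (\<lambda>\<phi>. even_hermite n (cos \<phi>))"
      unfolding even_hermite_def by (intro continuous_intros)
    show "continuous_on {0..pi / 2} (\<lambda>\<phi>. exp ((cos \<phi>)\<^sup>2 / 2) * a (cos \<phi>))"
      unfolding a_def using \<kappa> by (intro continuous_intros) auto
    fix \<phi> :: real assume "\<phi> \<in> {0..pi / 2}"
    then have "0 \<le> cos \<phi>" by (intro cos_ge_zero) auto
    then show "\<bar>even_hermite n (cos \<phi>) - exp ((cos \<phi>)\<^sup>2 / 2) * a (cos \<phi>)\<bar> \<le> P (cos \<phi>)"
      by (intro pointwise) auto
  qed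
  also have "\<dots> = 12484 / 20480 / \<kappa>\<^sup>2" by simp
  also have "\<dots> \<le> 61 / 100 / \<kappa>\<^sup>2" by (intro divide_right_mono) auto
  finally show ?thesis unfolding L a_def .
qed

text \<open>
With \<open>t = cos \<phi>\<close> and \<open>c = sin \<phi>\<close>, the coefficient of the sine is \<open>(t - t\<^sup>3/3)/2 = t (1 + c\<^sup>2/2)/3\<close>, and
\<open>(1 + c\<^sup>2/2) exp(- c\<^sup>2/2)\<close> differs from \<open>1\<close> only in fourth order. Hence the cosine part gives
\<open>J\<^sub>0 - J\<^sub>1/(2\<kappa>)\<close>, the sine part gives \<open>- J\<^sub>1/(3\<kappa>)\<close>, and the rest consists of the two averages
that were estimated above.
\<close>

lemma oscillating_average_near_Bessel:
  assumes \<kappa>: "0 < \<kappa>"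
  shows "\<bar>avg (\<lambda>\<phi>. exp ((cos \<phi>)\<^sup>2 / 2)
      * (cos (\<kappa> * cos \<phi>) - (cos \<phi> - cos \<phi> ^ 3 / 3) / (2 * \<kappa>) * sin (\<kappa> * cos \<phi>)))
    - exp (1 / 2) * (Bessel_J0 \<kappa> - 5 / 6 * (Bessel_J1 \<kappa> / \<kappa>))\<bar> \<le> exp (1 / 2) * (5 / 12) / \<kappa>\<^sup>2"
proof -
  define E where "E \<phi> = exp (- (sin \<phi>)\<^sup>2 / 2)" for \<phi> :: real
  define r where "r \<phi> = (E \<phi> - 1 + (sin \<phi>)\<^sup>2 / 2) * cos (\<kappa> * cos \<phi>)" for \<phi>
  define s where "s \<phi> = cos \<phi> * (1 - (1 + (sin \<phi>)\<^sup>2 / 2) * E \<phi>) * sin (\<kappa> * cos \<phi>)" for \<phi>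
  have r: "\<bar>avg r\<bar> \<le> 3 / (8 * \<kappa>\<^sup>2)" using fourth_order_cos_average_le [OF \<kappa>] by (simp add: r_def [abs_def] E_def)
  have s: "\<bar>avg s\<bar> \<le> 1 / (8 * \<kappa>)" using fourth_order_sin_average_le [OF \<kappa>] by (simp add: s_def [abs_def] E_def)
  have cr: "continuous_on {0..pi / 2} r" "continuous_on {0..pi / 2} s"
    unfolding r_def s_def E_def by (intro continuous_intros; simp)+
  have "exp ((cos \<phi>)\<^sup>2 / 2) * (cos (\<kappa> * cos \<phi>) - (cos \<phi> - cos \<phi> ^ 3 / 3) / (2 * \<kappa>) * sin (\<kappa> * cos \<phi>))
      = exp (1 / 2) * (cos (\<kappa> * cos \<phi>) - 1 / 2 * ((sin \<phi>)\<^sup>2 * cos (\<kappa> * cos \<phi>)) + r \<phi>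
        - 1 / (3 * \<kappa>) * (cos \<phi> * sin (\<kappa> * cos \<phi>)) + 1 / (3 * \<kappa>) * s \<phi>)" for \<phi>
  proof -
    have "(cos \<phi>)\<^sup>2 / 2 = 1 / 2 + - (sin \<phi>)\<^sup>2 / 2" by (simp add: cos_squared_eq field_simps)
    then have e: "exp ((cos \<phi>)\<^sup>2 / 2) = exp (1 / 2) * E \<phi>" unfolding E_def by (simp only: exp_add)
    have "cos \<phi> - cos \<phi> ^ 3 / 3 = cos \<phi> * (1 - (cos \<phi>)\<^sup>2 / 3)" by (simp add: field_simps eval_nat_numeral)
    also have "\<dots> = 2 / 3 * (cos \<phi> * (1 + (sin \<phi>)\<^sup>2 / 2))" by (simp add: cos_squared_eq field_simps)
    finally have q: "cos \<phi> - cos \<phi> ^ 3 / 3 = 2 / 3 * (cos \<phi> * (1 + (sin \<phi>)\<^sup>2 / 2))" .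
    have p: "(cos \<phi> - cos \<phi> ^ 3 / 3) / (2 * \<kappa>) = 1 / (3 * \<kappa>) * (cos \<phi> * (1 + (sin \<phi>)\<^sup>2 / 2))"
      unfolding q by simp
    show ?thesis unfolding e p r_def s_def by (simp add: algebra_simps)
  qed
  then have "avg (\<lambda>\<phi>. exp ((cos \<phi>)\<^sup>2 / 2)
      * (cos (\<kappa> * cos \<phi>) - (cos \<phi> - cos \<phi> ^ 3 / 3) / (2 * \<kappa>) * sin (\<kappa> * cos \<phi>)))
    = avg (\<lambda>\<phi>. exp (1 / 2) * (cos (\<kappa> * cos \<phi>) - 1 / 2 * ((sin \<phi>)\<^sup>2 * cos (\<kappa> * cos \<phi>)) + r \<phi>
        - 1 / (3 * \<kappa>) * (cos \<phi> * sin (\<kappa> * cos \<phi>)) + 1 / (3 * \<kappa>) * s \<phi>))"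
    by (simp only:)
  also have "\<dots> = exp (1 / 2) * (Bessel_J0 \<kappa> - 1 / 2 * avg (\<lambda>\<phi>. (sin \<phi>)\<^sup>2 * cos (\<kappa> * cos \<phi>)) + avg r
      - 1 / (3 * \<kappa>) * Bessel_J1 \<kappa> + 1 / (3 * \<kappa>) * avg s)"
    unfolding avg_cmult
    by (subst avg_add avg_diff, (intro continuous_intros cr)+)+ (simp only: avg_cmult Bessel_J0_def Bessel_J1_def)
  also have "avg (\<lambda>\<phi>. (sin \<phi>)\<^sup>2 * cos (\<kappa> * cos \<phi>)) = Bessel_J1 \<kappa> / \<kappa>"
    using \<kappa> by (intro avg_sin_square) simp
  also have "exp (1 / 2) * (Bessel_J0 \<kappa> - 1 / 2 * (Bessel_J1 \<kappa> / \<kappa>) + avg r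
      - 1 / (3 * \<kappa>) * Bessel_J1 \<kappa> + 1 / (3 * \<kappa>) * avg s)
    - exp (1 / 2) * (Bessel_J0 \<kappa> - 5 / 6 * (Bessel_J1 \<kappa> / \<kappa>)) = exp (1 / 2) * (avg r + 1 / (3 * \<kappa>) * avg s)"
    using \<kappa> by (simp add: field_simps)
  also have "\<bar>\<dots>\<bar> = exp (1 / 2) * \<bar>avg r + 1 / (3 * \<kappa>) * avg s\<bar>" by (simp add: abs_mult)
  also have "\<dots> \<le> exp (1 / 2) * (5 / 12 / \<kappa>\<^sup>2)"
  proof (rule mult_left_mono)
    have "1 / (3 * \<kappa>) * \<bar>avg s\<bar> \<le> 1 / (3 * \<kappa>) * (1 / (8 * \<kappa>))" using s \<kappa> by (intro mult_left_mono) auto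
    then have "\<bar>1 / (3 * \<kappa>) * avg s\<bar> \<le> 1 / (3 * \<kappa>) * (1 / (8 * \<kappa>))" using \<kappa> by (simp add: abs_mult)
    then have "\<bar>avg r + 1 / (3 * \<kappa>) * avg s\<bar> \<le> 3 / (8 * \<kappa>\<^sup>2) + 1 / (3 * \<kappa>) * (1 / (8 * \<kappa>))"
      using r by linarith
    also have "\<dots> = 5 / 12 / \<kappa>\<^sup>2" using \<kappa> by (simp add: field_simps power2_eq_square)
    finally show "\<bar>avg r + 1 / (3 * \<kappa>) * avg s\<bar> \<le> 5 / 12 / \<kappa>\<^sup>2" .
  qed simp
  finally show ?thesis by simp
qed

theorem theorem1:
  fixes n :: nat
  assumes "n \<ge> 1"
  shows "\<bar>Laguerre n 1
      - sqrt (exp 1 / pi) * (cos (2 * sqrt (real n) - pi / 4) / real n powr (1/4))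
      + 17 / 48 * sqrt (exp 1 / pi) * (sin (2 * sqrt (real n) - pi / 4) / real n powr (3/4))\<bar>
    < 0.51 / real n"
proof -
  define \<kappa> where "\<kappa> = 2 * sqrt (real n)"
  define \<alpha> where "\<alpha> = sqrt (2 / pi)"
  define c s where "c = cos (\<kappa> - pi / 4)" and "s = sin (\<kappa> - pi / 4)"
  define T where "T = exp (1 / 2) * (\<alpha> * (c - 17 / (24 * \<kappa>) * s) / sqrt \<kappa>)"
  define X where "X = Bessel_J0 \<kappa> - 5 / 6 * (Bessel_J1 \<kappa> / \<kappa>)"
  have n: "0 < real n" using assms by simp
  have "1 \<le> sqrt (real n)" using assms by simp
  then have \<kappa>: "2 \<le> \<kappa>" by (simp add: \<kappa>_def)
  then have k0: "0 < \<kappa>" by simp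
  have \<kappa>2: "\<kappa>\<^sup>2 = 4 * real n" by (simp add: \<kappa>_def power_mult_distrib)
  \<comment> \<open>The main terms in Bessel normalisation, with \<open>\<surd>e \<surd>(2/\<pi>) / \<surd>\<kappa> = \<surd>(e/\<pi>) n\<^sup>-\<^sup>1\<^sup>/\<^sup>4\<close>.\<close>
  have main: "sqrt (exp 1 / pi) * (c / real n powr (1/4)) - 17 / 48 * sqrt (exp 1 / pi) * (s / real n powr (3/4)) = T"
  proof -
    define w where "w = real n powr (1/4)"
    have w0: "0 < w" using n by (simp add: w_def)
    have w2: "sqrt (real n) = w\<^sup>2"
      using n by (simp add: w_def powr_half_sqrt [symmetric] powr_powr flip: powr_numeral)
    have w3: "real n powr (3/4) = w ^ 3"
      using n by (simp add: w_def powr_powr flip: powr_numeral)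
    have "sqrt (exp 1) = (exp (1 / 2) :: real)"
      by (rule real_sqrt_unique) (simp_all add: power2_eq_square flip: exp_add)
    then have e: "sqrt (exp 1 / pi) = exp (1 / 2) / sqrt pi" by (simp add: real_sqrt_divide)
    have k: "\<kappa> = 2 * w\<^sup>2" by (simp add: \<kappa>_def w2)
    have "sqrt \<kappa> = sqrt 2 * w" using w0 by (simp add: k real_sqrt_mult)
    moreover have "\<alpha> = sqrt 2 / sqrt pi" by (simp add: \<alpha>_def real_sqrt_divide)
    ultimately have a: "\<alpha> / sqrt \<kappa> = 1 / (sqrt pi * w)" by simp
    have "T = exp (1 / 2) * ((\<alpha> / sqrt \<kappa>) * (c - 17 / (24 * \<kappa>) * s))" by (simp add: T_def)
    also have "\<dots> = exp (1 / 2) * (1 / (sqrt pi * w) * (c - 17 / (48 * w\<^sup>2) * s))"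
      unfolding a unfolding k by simp
    also have "\<dots> = exp (1 / 2) / sqrt pi * (c / w) - 17 / 48 * (exp (1 / 2) / sqrt pi) * (s / w ^ 3)"
      using w0 by (simp add: field_simps eval_nat_numeral)
    finally show ?thesis unfolding e w3 w_def [symmetric] by simp
  qed
  have X: "\<bar>X - \<alpha> * (c - 17 / (24 * \<kappa>) * s) / sqrt \<kappa>\<bar> \<le> 71 / 160 / \<kappa>\<^sup>2"
  proof -
    have "2 / pi \<le> (4 / 5)\<^sup>2" using pi_approx by (simp add: power2_eq_square field_simps)
    then have \<alpha>: "\<alpha> \<le> 4 / 5" unfolding \<alpha>_def by (rule real_le_lsqrt [rotated]) auto
    have "100 / 71 \<le> sqrt \<kappa>" by (rule real_le_rsqrt) (use \<kappa> in \<open>simp add: power2_eq_square\<close>)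
    have "\<bar>sqrt \<kappa> * X - \<alpha> * (c - 17 / (24 * \<kappa>) * s)\<bar> \<le> 25 * \<alpha> / (32 * \<kappa>\<^sup>2)"
      using Bessel_combination_asymptotics [OF k0] by (simp only: X_def \<alpha>_def c_def s_def)
    moreover have "sqrt \<kappa> * X - y = sqrt \<kappa> * (X - y / sqrt \<kappa>)" for y
      using k0 by (simp add: right_diff_distrib)
    ultimately have "sqrt \<kappa> * \<bar>X - \<alpha> * (c - 17 / (24 * \<kappa>) * s) / sqrt \<kappa>\<bar> \<le> 25 * \<alpha> / (32 * \<kappa>\<^sup>2)"
      using k0 by (simp only: abs_mult abs_of_nonneg real_sqrt_ge_zero less_imp_le)
    moreover have "100 / 71 * \<bar>X - \<alpha> * (c - 17 / (24 * \<kappa>) * s) / sqrt \<kappa>\<bar>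
        \<le> sqrt \<kappa> * \<bar>X - \<alpha> * (c - 17 / (24 * \<kappa>) * s) / sqrt \<kappa>\<bar>"
      by (rule mult_right_mono [OF \<open>100 / 71 \<le> sqrt \<kappa>\<close>]) simp
    moreover have "25 * \<alpha> / (32 * \<kappa>\<^sup>2) \<le> 25 * (4 / 5) / (32 * \<kappa>\<^sup>2)"
      using \<alpha> by (intro divide_right_mono mult_left_mono) auto
    moreover have "25 * (4 / 5) / (32 * \<kappa>\<^sup>2) = 100 / 71 * (71 / 160 / \<kappa>\<^sup>2)" by simp
    ultimately have "100 / 71 * \<bar>X - \<alpha> * (c - 17 / (24 * \<kappa>) * s) / sqrt \<kappa>\<bar> \<le> 100 / 71 * (71 / 160 / \<kappa>\<^sup>2)"
      by linarith
    then show ?thesis by simp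
  qed
  define M where "M = avg (\<lambda>\<phi>. exp ((cos \<phi>)\<^sup>2 / 2)
      * (cos (\<kappa> * cos \<phi>) - (cos \<phi> - cos \<phi> ^ 3 / 3) / (2 * \<kappa>) * sin (\<kappa> * cos \<phi>)))"
  have LM: "\<bar>Laguerre n 1 - M\<bar> \<le> 61 / 100 / \<kappa>\<^sup>2"
    unfolding M_def \<kappa>_def by (rule Laguerre_near_oscillating_average [OF assms])
  have "\<bar>M - exp (1 / 2) * X\<bar> \<le> exp (1 / 2) * (5 / 12) / \<kappa>\<^sup>2"
    unfolding M_def X_def by (rule oscillating_average_near_Bessel [OF k0])
  also have "\<dots> \<le> 33 / 20 * (5 / 12) / \<kappa>\<^sup>2"
    using exp_half_le by (intro divide_right_mono mult_right_mono) auto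
  finally have MX: "\<bar>M - exp (1 / 2) * X\<bar> \<le> 33 / 20 * (5 / 12) / \<kappa>\<^sup>2" .
  have "\<bar>exp (1 / 2) * X - T\<bar> = exp (1 / 2) * \<bar>X - \<alpha> * (c - 17 / (24 * \<kappa>) * s) / sqrt \<kappa>\<bar>"
    by (simp only: T_def abs_mult abs_exp_cancel flip: right_diff_distrib)
  also have "\<dots> \<le> 33 / 20 * (71 / 160 / \<kappa>\<^sup>2)"
    using exp_half_le X by (intro mult_mono) auto
  finally have XT: "\<bar>exp (1 / 2) * X - T\<bar> \<le> 33 / 20 * (71 / 160 / \<kappa>\<^sup>2)" .
  \<comment> \<open>For \<open>\<kappa> \<ge> 2\<close> the three errors, times \<open>\<kappa>\<^sup>2\<close>, are at most \<open>0.61\<close>, \<open>0.6875\<close> and \<open>0.7322\<close>.\<close>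
  have "\<bar>Laguerre n 1 - T\<bar> \<le> 61 / 100 / \<kappa>\<^sup>2 + 33 / 20 * (5 / 12) / \<kappa>\<^sup>2 + 33 / 20 * (71 / 160 / \<kappa>\<^sup>2)"
  proof -
    have "\<bar>a - e\<bar> \<le> u + v + w" if "\<bar>a - b\<bar> \<le> u" "\<bar>b - d\<bar> \<le> v" "\<bar>d - e\<bar> \<le> w" for a b d e u v w :: real
      using that by linarith
    from this [OF LM MX XT] show ?thesis .
  qed
  also have "\<dots> = (61 / 100 + 33 / 20 * (5 / 12) + 33 / 20 * (71 / 160)) / 4 / real n"
    unfolding \<kappa>2 by (simp add: add_divide_distrib)
  also have "\<dots> < 0.51 / real n"
    using n by (intro divide_strict_right_mono) simp_all
  finally show ?thesis unfolding main [symmetric] c_def s_def \<kappa>_def by (simp add: algebra_simps)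
qed

end
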